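(* Let $U\subset C^1$ be open and let $f:U\to\mathbb{R}^n$ be a $C^1_F$-smooth map with property (e) such that $$X_f=\{\phi\in U:\phi'(0)=f(\phi)\}\neq\emptyset.$$ Then $X_f$ is a $C^1_F$-submanifold of codimension $n$ in the space $C^1$, with tangent spaces $$T_{\phi}X_f=\{\chi\in C^1:\chi'(0)=Df(\phi)\chi\}\quad\text{for all }\phi\in X_f.$$
   Context: Fix $n\in\mathbb{N}$. $C$ is the Fréchet space of continuous maps $(-\infty,0]\to\mathbb{R}^n$ with the topology of locally uniform convergence. $C^1$ is the Fréchet space of continuously differentiable maps $(-\infty,0]\to\mathbb{R}^n$ with the topology of locally uniform convergence of maps and their derivatives. For topological vector spaces $V,W$, $L_c(V,W)$ is the space of continuous linear maps $V\to W$; the topology $\beta$ on it is that of uniform convergence on bounded sets (basic neighbourhoods of $0$: $\{A: AB\subset N\}$ with $B\subset V$ bounded and $N$ a neighbourhood of $0$ in $W$). A continuous map $f:V\supset U\to W$, $U$ open, is $C^1_F$-smooth if all directional derivatives $Df(u)v=\lim_{0\ne t\to0}\frac1t(f(u+tv)-f(u))$, $u\in U$, $v\in V$, exist, each $Df(u):V\to W$ is linear and continuous, and $U\ni u\mapsto Df(u)\in L_c(V,W)$ is continuous with respect to $\beta$. Property (e): each derivative $Df(\phi):C^1\to\mathbb{R}^n$, $\phi\in U$, has a linear extension $D_ef(\phi):C\to\mathbb{R}^n$, and the map $U\times C\ni(\phi,\chi)\mapsto D_ef(\phi)\chi\in\mathbb{R}^n$ is continuous. A $C^1_F$-diffeomorphism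 is an injective $C^1_F$-map from an open subset of a Fréchet space onto an open subset of a Fréchet space with $C^1_F$-smooth inverse. A subset $M$ of a Fréchet space $F=G\oplus H$ ($G,H$ closed subspaces) is a $C^1_F$-submanifold (modelled over $G$) if for each $m\in M$ there are an open neighbourhood $O$ of $m$ in $F$ and a $C^1_F$-diffeomorphism $K$ from $O$ onto an open set $W\subset F$ with $K(M\cap O)=W\cap G$; its codimension is $\dim H$. $T_mM$ is the set of all tangent vectors $c'(0)$ of continuously differentiable curves $c:I\to F$, $I$ an open interval containing $0$, with $c(0)=m$ and $c(I)\subset M$. *)

theory Defs
  imports "HOL-Analysis.Analysis"
begin

section \<open>Hausdorff topological vector spaces\<close>

class real_tvs = real_vector + topological_ab_group_add + t2_space +
  assumes tendsto_scaleR_nhds: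
    "((\<lambda>p. fst p *\<^sub>R snd p) \<longlongrightarrow> a *\<^sub>R x) (nhds a \<times>\<^sub>F nhds x)"

instance real_normed_vector \<subseteq> real_tvs
  by standard
    (intro tendsto_scaleR tendsto_fst tendsto_snd;
     simp add: filterlim_fst filterlim_snd)

text \<open>Boundedness in the sense of von Neumann; the library's \<open>bounded\<close> is metric.\<close>

definition tvs_bounded :: "'a::real_tvs set \<Rightarrow> bool" where
  "tvs_bounded B \<longleftrightarrow>
    (\<forall>N. open N \<and> 0 \<in> N \<longrightarrow> (\<exists>r>0. \<forall>s\<ge>r. B \<subseteq> (\<lambda>x. s *\<^sub>R x) ` N))"

lemma tvs_bounded_Un:
  assumes "tvs_bounded A" "tvs_bounded B" shows "tvs_bounded (A \<union> B)"
  unfolding tvs_bounded_def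
proof (intro allI impI)
  fix N :: "'a set" assume N: "open N \<and> 0 \<in> N"
  obtain r1 where r1: "r1 > 0" "\<forall>s\<ge>r1. A \<subseteq> (\<lambda>x. s *\<^sub>R x) ` N"
    using assms(1) N unfolding tvs_bounded_def by blast
  obtain r2 where r2: "r2 > 0" "\<forall>s\<ge>r2. B \<subseteq> (\<lambda>x. s *\<^sub>R x) ` N"
    using assms(2) N unfolding tvs_bounded_def by blast
  have "\<forall>s\<ge>max r1 r2. A \<union> B \<subseteq> (\<lambda>x. s *\<^sub>R x) ` N"
    using r1 r2 by (meson Un_least max.bounded_iff)
  then show "\<exists>r>0. \<forall>s\<ge>r. A \<union> B \<subseteq> (\<lambda>x. s *\<^sub>R x) ` N"
    using r1(1) by (intro exI[of _ "max r1 r2"]) auto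
qed

lemma tvs_bounded_empty: "tvs_bounded {}"
  unfolding tvs_bounded_def by (auto intro: exI[of _ 1])

definition Lc :: "('a::real_tvs \<Rightarrow> 'b::real_tvs) set" where
  "Lc = {A. linear A \<and> continuous_on UNIV A}"

text \<open>The topology \<open>\<beta>\<close> on \<^const>\<open>Lc\<close>: the basic neighbourhoods of \<open>A\<close> are the translates
  by \<open>A\<close> of the sets of all \<open>A'\<close> mapping \<open>B\<close> into \<open>N\<close>, for \<open>B\<close> bounded and \<open>N\<close> a
  neighbourhood of zero.\<close>

definition beta_open :: "('a::real_tvs \<Rightarrow> 'b::real_tvs) set \<Rightarrow> bool" where
  "beta_open S \<longleftrightarrow> S \<subseteq> Lc \<and>
    (\<forall>A\<in>S. \<exists>B N. tvs_bounded B \<and> open N \<and> 0 \<in> N \<and>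
        {A' \<in> Lc. (\<lambda>x. A' x - A x) ` B \<subseteq> N} \<subseteq> S)"

definition beta :: "('a::real_tvs \<Rightarrow> 'b::real_tvs) topology" where
  "beta = topology beta_open"

lemma istopology_beta_open: "istopology (beta_open :: ('a::real_tvs \<Rightarrow> 'b::real_tvs) set \<Rightarrow> bool)"
  unfolding istopology_def
proof (intro conjI allI impI)
  fix S T :: "('a \<Rightarrow> 'b) set" assume S: "beta_open S" and T: "beta_open T"
  show "beta_open (S \<inter> T)"
    unfolding beta_open_def
  proof (intro conjI ballI)
    show "S \<inter> T \<subseteq> Lc" using S unfolding beta_open_def by blast
  next
    fix A assume A: "A \<in> S \<inter> T"
    obtain B N where 1: "tvs_bounded B" "open N" "0 \<in> N"
        "{A' \<in> Lc. (\<lambda>x. A' x - A x) ` B \<subseteq> N} \<subseteq> S"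
      using S A unfolding beta_open_def by blast
    obtain B' N' where 2: "tvs_bounded B'" "open N'" "0 \<in> N'"
        "{A' \<in> Lc. (\<lambda>x. A' x - A x) ` B' \<subseteq> N'} \<subseteq> T"
      using T A unfolding beta_open_def by blast
    have "{A' \<in> Lc. (\<lambda>x. A' x - A x) ` (B \<union> B') \<subseteq> N \<inter> N'} \<subseteq> S \<inter> T"
      using 1(4) 2(4) by blast
    then show "\<exists>B N. tvs_bounded B \<and> open N \<and> 0 \<in> N \<and>
        {A' \<in> Lc. (\<lambda>x. A' x - A x) ` B \<subseteq> N} \<subseteq> S \<inter> T"
      using tvs_bounded_Un[OF 1(1) 2(1)] 1(2,3) 2(2,3)
      by (intro exI[of _ "B \<union> B'"] exI[of _ "N \<inter> N'"]) auto
  qed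
next
  fix K :: "('a \<Rightarrow> 'b) set set" assume K: "\<forall>S\<in>K. beta_open S"
  show "beta_open (\<Union>K)"
    unfolding beta_open_def
  proof (intro conjI ballI)
    show "\<Union>K \<subseteq> Lc" using K unfolding beta_open_def by blast
  next
    fix A assume "A \<in> \<Union>K"
    then obtain S where S: "S \<in> K" "A \<in> S" by blast
    have "beta_open S" using K S(1) by blast
    then obtain B N where BN: "tvs_bounded B" "open N" "0 \<in> N"
        "{A' \<in> Lc. (\<lambda>x. A' x - A x) ` B \<subseteq> N} \<subseteq> S"
      using S(2) unfolding beta_open_def by blast
    have "{A' \<in> Lc. (\<lambda>x. A' x - A x) ` B \<subseteq> N} \<subseteq> \<Union>K"
      by (rule order_trans[OF BN(4) Union_upper[OF S(1)]])
    with BN(1-3)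
    show "\<exists>B N. tvs_bounded B \<and> open N \<and> 0 \<in> N \<and>
        {A' \<in> Lc. (\<lambda>x. A' x - A x) ` B \<subseteq> N} \<subseteq> \<Union>K"
      by (intro exI conjI)
  qed
qed

lemma openin_beta: "openin beta S \<longleftrightarrow> beta_open S"
  unfolding beta_def by (simp add: topology_inverse' istopology_beta_open)

lemma topspace_beta: "topspace beta = Lc"
proof -
  have "beta_open Lc"
    unfolding beta_open_def
    by (intro conjI ballI exI[of _ "{}"] exI[of _ UNIV]) (auto simp: tvs_bounded_empty)
  then show ?thesis
    unfolding topspace_def openin_beta beta_open_def by blast
qed


section \<open>The smoothness class \<open>C\<^sup>1\<^sub>F\<close>, submanifolds, tangent vectors\<close>

definition has_dir_deriv ::
    "('a::real_tvs \<Rightarrow> 'b::real_tvs) \<Rightarrow> 'a \<Rightarrow> 'a \<Rightarrow> 'b \<Rightarrow> bool" where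
  "has_dir_deriv f u v l \<longleftrightarrow> ((\<lambda>t::real. (1 / t) *\<^sub>R (f (u + t *\<^sub>R v) - f u)) \<longlongrightarrow> l) (at 0)"

definition DF :: "('a::real_tvs \<Rightarrow> 'b::real_tvs) \<Rightarrow> 'a \<Rightarrow> 'a \<Rightarrow> 'b" where
  "DF f u v = (THE l. has_dir_deriv f u v l)"

text \<open>Maps with open domain \<open>U\<close> are total functions whose values outside \<open>U\<close> are irrelevant:
  for \<open>u \<in> U\<close> the limit in \<^const>\<open>has_dir_deriv\<close> only depends on the values on \<open>U\<close>.\<close>

definition C1F_on :: "'a::real_tvs set \<Rightarrow> ('a \<Rightarrow> 'b::real_tvs) \<Rightarrow> bool" where
  "C1F_on U f \<longleftrightarrow>
     open U \<and> continuous_on U f \<and>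
     (\<forall>u\<in>U. \<forall>v. \<exists>l. has_dir_deriv f u v l) \<and>
     (\<forall>u\<in>U. linear (DF f u) \<and> continuous_on UNIV (DF f u)) \<and>
     continuous_map (top_of_set U) beta (DF f)"

definition C1F_diffeomorphism ::
    "'a::real_tvs set \<Rightarrow> 'b::real_tvs set \<Rightarrow> ('a \<Rightarrow> 'b) \<Rightarrow> bool" where
  "C1F_diffeomorphism P W K \<longleftrightarrow>
     open P \<and> open W \<and> inj_on K P \<and> K ` P = W \<and> C1F_on P K \<and> C1F_on W (inv_into P K)"

definition closed_direct_sum :: "'a::real_tvs set \<Rightarrow> 'a set \<Rightarrow> bool" where
  "closed_direct_sum G H \<longleftrightarrow>
     subspace G \<and> closed G \<and> subspace H \<and> closed H \<and>
     G \<inter> H = {0} \<and> {g + h |g h. g \<in> G \<and> h \<in> H} = UNIV"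

definition C1F_submanifold_over :: "'a::real_tvs set \<Rightarrow> 'a set \<Rightarrow> bool" where
  "C1F_submanifold_over G M \<longleftrightarrow>
     (\<forall>m\<in>M. \<exists>P W K. m \<in> P \<and> C1F_diffeomorphism P W K \<and> K ` (M \<inter> P) = W \<inter> G)"

text \<open>Finite dimensionality of \<open>H\<close> is required explicitly because \<^const>\<open>dim\<close> is \<open>0\<close> on
  infinite-dimensional spaces.\<close>

definition C1F_submanifold_codim :: "'a::real_tvs set \<Rightarrow> nat \<Rightarrow> bool" where
  "C1F_submanifold_codim M k \<longleftrightarrow>
     (\<exists>G H. closed_direct_sum G H \<and> (\<exists>B. finite B \<and> span B = H) \<and> dim H = k \<and>
            C1F_submanifold_over G M)"

text \<open>For a curve \<open>c\<close>, the vector \<^term>\<open>DF c t 1\<close> is \<open>c'(t)\<close>.\<close>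

definition C1_curve_on :: "real set \<Rightarrow> (real \<Rightarrow> 'a::real_tvs) \<Rightarrow> bool" where
  "C1_curve_on I c \<longleftrightarrow>
     (\<forall>t\<in>I. \<exists>l. has_dir_deriv c t 1 l) \<and> continuous_on I (\<lambda>t. DF c t 1)"

definition tangent_vectors :: "'a::real_tvs \<Rightarrow> 'a set \<Rightarrow> 'a set" where
  "tangent_vectors m M =
     {DF c 0 1 |c I. open I \<and> is_interval I \<and> 0 \<in> I \<and> C1_curve_on I c \<and> c 0 = m \<and> c ` I \<subseteq> M}"


section \<open>The space \<open>C\<close>\<close>

text \<open>A map on \<open>{..0}\<close> is represented by its extension by zero to the real line.\<close>

typedef (overloaded) 'a cmap =
  "{f :: real \<Rightarrow> 'a::real_normed_vector. continuous_on {..0} f \<and> (\<forall>t>0. f t = 0)}"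
  morphisms cmap_apply Abs_cmap
  by (rule exI[of _ "\<lambda>_. 0"]) simp

setup_lifting type_definition_cmap

lemma cmap_eqI: "(\<And>t. t \<le> 0 \<Longrightarrow> cmap_apply x t = cmap_apply y t) \<Longrightarrow> x = y"
  by transfer (metis ext not_le)

lemma continuous_on_cmap: "continuous_on {..0} (cmap_apply x)"
  using cmap_apply[of x] by simp

instantiation cmap :: (real_normed_vector) real_vector
begin
lift_definition zero_cmap :: "'a cmap" is "\<lambda>_. 0" by simp
lift_definition plus_cmap :: "'a cmap \<Rightarrow> 'a cmap \<Rightarrow> 'a cmap" is "\<lambda>f g t. f t + g t"
  by (auto intro: continuous_intros)
lift_definition minus_cmap :: "'a cmap \<Rightarrow> 'a cmap \<Rightarrow> 'a cmap" is "\<lambda>f g t. f t - g t"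
  by (auto intro: continuous_intros)
lift_definition uminus_cmap :: "'a cmap \<Rightarrow> 'a cmap" is "\<lambda>f t. - f t"
  by (auto intro: continuous_intros)
lift_definition scaleR_cmap :: "real \<Rightarrow> 'a cmap \<Rightarrow> 'a cmap" is "\<lambda>r f t. r *\<^sub>R f t"
  by (auto intro: continuous_intros)
instance
  by standard (transfer; simp add: algebra_simps fun_eq_iff)+
end

definition near :: "real \<Rightarrow> real \<Rightarrow> 'a::real_normed_vector cmap \<Rightarrow> 'a cmap \<Rightarrow> bool" where
  "near k e x y \<longleftrightarrow> (\<forall>t\<in>{-k..0}. norm (cmap_apply y t - cmap_apply x t) < e)"

lemma near_mono: "near k e x y \<Longrightarrow> k' \<le> k \<Longrightarrow> e \<le> e' \<Longrightarrow> near k' e' x y"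
  unfolding near_def by (meson atLeastAtMost_iff less_le_trans neg_le_iff_le order_trans)

instantiation cmap :: (real_normed_vector) topological_space
begin

definition open_cmap :: "'a cmap set \<Rightarrow> bool" where
  "open_cmap S \<longleftrightarrow> (\<forall>x\<in>S. \<exists>k. \<exists>e>0. \<forall>y. near k e x y \<longrightarrow> y \<in> S)"

instance
proof
  show "open (UNIV :: 'a cmap set)"
    unfolding open_cmap_def by (auto intro: exI[of _ 1])
next
  fix S T :: "'a cmap set" assume S: "open S" and T: "open T"
  show "open (S \<inter> T)"
    unfolding open_cmap_def
  proof
    fix x assume x: "x \<in> S \<inter> T"
    obtain k e where 1: "e > 0" "\<forall>y. near k e x y \<longrightarrow> y \<in> S"
      using S x unfolding open_cmap_def by blast
    obtain k' e' where 2: "e' > 0" "\<forall>y. near k' e' x y \<longrightarrow> y \<in> T"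
      using T x unfolding open_cmap_def by blast
    have "\<forall>y. near (max k k') (min e e') x y \<longrightarrow> y \<in> S \<inter> T"
      using 1(2) 2(2) by (meson Int_iff max.cobounded1 max.cobounded2 min.cobounded1
          min.cobounded2 near_mono)
    then show "\<exists>k. \<exists>e>0. \<forall>y. near k e x y \<longrightarrow> y \<in> S \<inter> T"
      using 1(1) 2(1) by (intro exI[of _ "max k k'"] exI[of _ "min e e'"]) auto
  qed
next
  fix K :: "'a cmap set set" assume "\<forall>S\<in>K. open S"
  then show "open (\<Union>K)"
    unfolding open_cmap_def by (meson UnionE UnionI)
qed

end

lemma eventually_nhds_near:
  assumes "e > 0" shows "eventually (near k e x) (nhds x)"
proof -
  let ?S = "{y. \<exists>d<e. \<forall>t\<in>{-k..0}. norm (cmap_apply y t - cmap_apply x t) \<le> d}"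
  have "open ?S"
    unfolding open_cmap_def
  proof
    fix y assume "y \<in> ?S"
    then obtain d where d: "d < e" "\<forall>t\<in>{-k..0}. norm (cmap_apply y t - cmap_apply x t) \<le> d"
      by blast
    have "z \<in> ?S" if z: "near k ((e - d) / 2) y z" for z
    proof -
      have "norm (cmap_apply z t - cmap_apply x t) \<le> (e + d) / 2" if t: "t \<in> {-k..0}" for t
      proof -
        have "norm (cmap_apply z t - cmap_apply x t)
            \<le> norm (cmap_apply z t - cmap_apply y t) + norm (cmap_apply y t - cmap_apply x t)"
          using norm_triangle_ineq[of "cmap_apply z t - cmap_apply y t"
              "cmap_apply y t - cmap_apply x t"] by simp
        also have "\<dots> \<le> (e - d) / 2 + d"
          using z d(2) t unfolding near_def by (intro add_mono) (auto intro: less_imp_le)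
        also have "\<dots> = (e + d) / 2" by (simp add: field_simps)
        finally show ?thesis .
      qed
      moreover have "(e + d) / 2 < e" using d(1) by simp
      ultimately show ?thesis by blast
    qed
    then show "\<exists>k. \<exists>e>0. \<forall>z. near k e y z \<longrightarrow> z \<in> ?S"
      using d(1) by (intro exI[of _ k] exI[of _ "(e - d) / 2"]) auto
  qed
  moreover have "x \<in> ?S" using assms by (auto intro!: exI[of _ 0])
  moreover have "\<forall>y\<in>?S. near k e x y" unfolding near_def by fastforce
  ultimately show ?thesis unfolding eventually_nhds by blast
qed

lemma tendsto_cmap_iff:
  "(f \<longlongrightarrow> x) F \<longleftrightarrow> (\<forall>k. \<forall>e>0. eventually (\<lambda>s. near k e x (f s)) F)"
proof
  assume "(f \<longlongrightarrow> x) F"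
  then show "\<forall>k. \<forall>e>0. eventually (\<lambda>s. near k e x (f s)) F"
    using eventually_nhds_near filterlim_iff by blast
next
  assume *: "\<forall>k. \<forall>e>0. eventually (\<lambda>s. near k e x (f s)) F"
  show "(f \<longlongrightarrow> x) F"
  proof (rule topological_tendstoI)
    fix S assume "open S" "x \<in> S"
    then obtain k e where "e > 0" "\<forall>y. near k e x y \<longrightarrow> y \<in> S"
      unfolding open_cmap_def by blast
    then show "eventually (\<lambda>s. f s \<in> S) F"
      using * by (metis (mono_tags, lifting) eventually_mono)
  qed
qed

lemma tendsto_add_cmap:
  fixes f g :: "'s \<Rightarrow> 'a::real_normed_vector cmap"
  assumes "(f \<longlongrightarrow> x) F" "(g \<longlongrightarrow> y) F"
  shows "((\<lambda>s. f s + g s) \<longlongrightarrow> x + y) F"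
  unfolding tendsto_cmap_iff
proof (intro allI impI)
  fix k e :: real assume "e > 0"
  then have "eventually (\<lambda>s. near k (e/2) x (f s) \<and> near k (e/2) y (g s)) F"
    using assms unfolding tendsto_cmap_iff by (simp add: eventually_conj)
  then show "eventually (\<lambda>s. near k e (x + y) (f s + g s)) F"
  proof (rule eventually_mono)
    fix s assume "near k (e/2) x (f s) \<and> near k (e/2) y (g s)"
    then show "near k e (x + y) (f s + g s)"
      unfolding near_def plus_cmap.rep_eq add_diff_add
      by (metis field_sum_of_halves norm_add_less)
  qed
qed

lemma tendsto_scaleR_cmap:
  fixes f :: "'s \<Rightarrow> 'a::real_normed_vector cmap"
  assumes a: "(a \<longlongrightarrow> b) F" and f: "(f \<longlongrightarrow> x) F"
  shows "((\<lambda>s. a s *\<^sub>R f s) \<longlongrightarrow> b *\<^sub>R x) F"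
  unfolding tendsto_cmap_iff
proof (intro allI impI)
  fix k e :: real assume e: "e > 0"
  have "compact (cmap_apply x ` {-k..0})"
    by (intro compact_continuous_image continuous_on_subset[OF continuous_on_cmap]) auto
  then obtain M where M: "M > 0" "\<forall>t\<in>{-k..0}. norm (cmap_apply x t) \<le> M"
    by (metis bounded_pos compact_imp_bounded image_eqI)
  define d where "d = e / (2 * (\<bar>b\<bar> + 1))"
  have d: "d > 0" "(\<bar>b\<bar> + 1) * d = e / 2" unfolding d_def using e by (auto simp: field_simps)
  have "eventually (\<lambda>s. dist (a s) b < min 1 (e / (2 * M))) F"
    using e M(1) by (intro tendstoD[OF a]) simp
  moreover have "eventually (\<lambda>s. near k d x (f s)) F"
    using f d(1) unfolding tendsto_cmap_iff by blast
  ultimately have "eventually (\<lambda>s. dist (a s) b < min 1 (e / (2 * M)) \<and> near k d x (f s)) F"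
    by (rule eventually_conj)
  then show "eventually (\<lambda>s. near k e (b *\<^sub>R x) (a s *\<^sub>R f s)) F"
  proof (rule eventually_mono)
    fix s assume s: "dist (a s) b < min 1 (e / (2 * M)) \<and> near k d x (f s)"
    show "near k e (b *\<^sub>R x) (a s *\<^sub>R f s)"
      unfolding near_def scaleR_cmap.rep_eq
    proof
      fix t assume t: "t \<in> {-k..0}"
      let ?y = "cmap_apply (f s) t" and ?x = "cmap_apply x t"
      have eq: "a s *\<^sub>R ?y - b *\<^sub>R ?x = a s *\<^sub>R (?y - ?x) + (a s - b) *\<^sub>R ?x"
        by (simp add: algebra_simps)
      have 1: "norm (a s *\<^sub>R (?y - ?x)) \<le> (\<bar>b\<bar> + 1) * d"
        unfolding norm_scaleR using s t unfolding near_def dist_real_def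
        by (intro mult_mono) (auto intro: less_imp_le)
      have "norm ((a s - b) *\<^sub>R ?x) \<le> \<bar>a s - b\<bar> * M"
        using M t by (simp add: mult_left_mono)
      also have "\<dots> < e / (2 * M) * M"
        using s M(1) unfolding dist_real_def by (intro mult_strict_right_mono) auto
      also have "\<dots> = e / 2" using M(1) by simp
      finally have 2: "norm ((a s - b) *\<^sub>R ?x) < e / 2" .
      show "norm (a s *\<^sub>R ?y - b *\<^sub>R ?x) < e"
        unfolding eq using norm_triangle_ineq[of "a s *\<^sub>R (?y - ?x)" "(a s - b) *\<^sub>R ?x"] 1 2 d(2)
        by linarith
    qed
  qed
qed

instance cmap :: (real_normed_vector) t2_space
proof
  fix x y :: "'a cmap" assume "x \<noteq> y"
  then obtain t where t: "t \<le> 0" "cmap_apply x t \<noteq> cmap_apply y t"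
    using cmap_eqI by metis
  define e where "e = norm (cmap_apply x t - cmap_apply y t) / 2"
  have e: "e > 0" unfolding e_def using t by simp
  obtain S where S: "open S" "x \<in> S" "\<forall>z\<in>S. near (-t) e x z"
    using eventually_nhds_near[OF e] unfolding eventually_nhds by blast
  obtain T where T: "open T" "y \<in> T" "\<forall>z\<in>T. near (-t) e y z"
    using eventually_nhds_near[OF e] unfolding eventually_nhds by blast
  have "S \<inter> T = {}"
  proof (rule ccontr)
    assume "S \<inter> T \<noteq> {}"
    then obtain z where "near (-t) e x z" "near (-t) e y z" using S T by blast
    then have "dist (cmap_apply z t) (cmap_apply x t) < e" "dist (cmap_apply z t) (cmap_apply y t) < e"
      unfolding near_def dist_norm using t(1) by auto
    then have "dist (cmap_apply x t) (cmap_apply y t) < e + e"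
      by (metis dist_commute dist_triangle_less_add)
    then show False unfolding e_def dist_norm by simp
  qed
  then show "\<exists>S T. open S \<and> open T \<and> x \<in> S \<and> y \<in> T \<and> S \<inter> T = {}"
    using S T by blast
qed

instance cmap :: (real_normed_vector) real_tvs
proof
  fix a b :: "'a cmap"
  show "((\<lambda>x. fst x + snd x) \<longlongrightarrow> a + b) (nhds a \<times>\<^sub>F nhds b)"
    by (intro tendsto_add_cmap filterlim_fst filterlim_snd)
  show "(uminus \<longlongrightarrow> - a) (nhds a)"
    using tendsto_scaleR_cmap[OF tendsto_const[of "-1"] filterlim_ident[of "nhds a"]] by simp
next
  fix a :: real and x :: "'a cmap"
  show "((\<lambda>p. fst p *\<^sub>R snd p) \<longlongrightarrow> a *\<^sub>R x) (nhds a \<times>\<^sub>F nhds x)"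
    by (intro tendsto_scaleR_cmap filterlim_fst filterlim_snd)
qed


section \<open>The space \<open>C\<^sup>1\<close>\<close>

text \<open>Derivatives are taken within \<open>{..0}\<close>; at \<open>0\<close> this is the left derivative.\<close>

definition C1_left :: "(real \<Rightarrow> 'a::real_normed_vector) \<Rightarrow> bool" where
  "C1_left f \<longleftrightarrow>
     (\<forall>t\<le>0. f differentiable (at t within {..0})) \<and>
     continuous_on {..0} (\<lambda>t. vector_derivative f (at t within {..0}))"

lemma vector_derivative_left:
  assumes "(f has_vector_derivative d) (at t within {..0})" "t \<le> (0::real)"
  shows "vector_derivative f (at t within {..0}) = d"
proof (rule vector_derivative_within[OF _ assms(1)])
  show "at t within {..0} \<noteq> bot"
    using assms(2) islimpt_subset[of t "{t - 1..t}" "{..0}"]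
    by (simp add: trivial_limit_within islimpt_Icc)
qed

lemma C1_leftI:
  assumes "\<And>t. t \<le> 0 \<Longrightarrow> (f has_vector_derivative g t) (at t within {..0})"
    and "continuous_on {..0} g"
  shows "C1_left f"
  unfolding C1_left_def
proof (intro conjI allI impI)
  show "f differentiable (at t within {..0})" if "t \<le> 0" for t
    using assms(1)[OF that] by (rule differentiableI_vector)
  have "continuous_on {..0} (\<lambda>t. vector_derivative f (at t within {..0})) \<longleftrightarrow> continuous_on {..0} g"
    using assms(1) by (intro continuous_on_cong) (auto intro: vector_derivative_left)
  then show "continuous_on {..0} (\<lambda>t. vector_derivative f (at t within {..0}))"
    using assms(2) by simp
qed

lemma C1_leftD:
  assumes "C1_left f" "t \<le> 0"
  shows "(f has_vector_derivative vector_derivative f (at t within {..0})) (at t within {..0})"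
  using assms unfolding C1_left_def by (simp add: vector_derivative_works)

lemma C1_left_imp_continuous_on: "C1_left f \<Longrightarrow> continuous_on {..0} f"
  unfolding C1_left_def
  by (simp add: continuous_on_eq_continuous_within differentiable_imp_continuous_within)

lemma C1_left_add: "C1_left f \<Longrightarrow> C1_left g \<Longrightarrow> C1_left (\<lambda>t. f t + g t)"
  by (rule C1_leftI, rule has_vector_derivative_add; (erule C1_leftD)?)
    (auto simp: C1_left_def intro!: continuous_intros)

lemma C1_left_scaleR: "C1_left f \<Longrightarrow> C1_left (\<lambda>t. r *\<^sub>R f t)"
  by (rule C1_leftI,
      rule bounded_linear.has_vector_derivative[OF bounded_linear_scaleR_right]; (erule C1_leftD)?)
    (auto simp: C1_left_def intro!: continuous_intros)

lemma C1_left_zero: "C1_left (\<lambda>_. 0)"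
  by (rule C1_leftI[where g = "\<lambda>_. 0"]) auto

typedef (overloaded) 'a c1map =
  "{f :: real \<Rightarrow> 'a::real_normed_vector. C1_left f \<and> (\<forall>t>0. f t = 0)}"
  morphisms c1map_apply Abs_c1map
  using C1_left_zero by (intro exI[of _ "\<lambda>_. 0"]) simp

setup_lifting type_definition_c1map

instantiation c1map :: (real_normed_vector) real_vector
begin
lift_definition zero_c1map :: "'a c1map" is "\<lambda>_. 0" by (simp add: C1_left_zero)
lift_definition plus_c1map :: "'a c1map \<Rightarrow> 'a c1map \<Rightarrow> 'a c1map" is "\<lambda>f g t. f t + g t"
  by (simp add: C1_left_add)
lift_definition minus_c1map :: "'a c1map \<Rightarrow> 'a c1map \<Rightarrow> 'a c1map" is "\<lambda>f g t. f t - g t"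
  subgoal for f g using C1_left_add[of f "\<lambda>t. (-1) *\<^sub>R g t"] C1_left_scaleR[of g "-1"] by simp
  done
lift_definition uminus_c1map :: "'a c1map \<Rightarrow> 'a c1map" is "\<lambda>f t. - f t"
  subgoal for f using C1_left_scaleR[of f "-1"] by simp
  done
lift_definition scaleR_c1map :: "real \<Rightarrow> 'a c1map \<Rightarrow> 'a c1map" is "\<lambda>r f t. r *\<^sub>R f t"
  by (simp add: C1_left_scaleR)
instance
  by standard (transfer; simp add: algebra_simps fun_eq_iff)+
end

lift_definition c1_incl :: "'a::real_normed_vector c1map \<Rightarrow> 'a cmap" is "\<lambda>f. f"
  by (simp add: C1_left_imp_continuous_on)

lift_definition c1_deriv :: "'a::real_normed_vector c1map \<Rightarrow> 'a cmap"
  is "\<lambda>f t. if t \<le> 0 then vector_derivative f (at t within {..0}) else 0"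
  subgoal for f
    using continuous_on_cong[of "{..0}" "{..0}"
        "\<lambda>t. if t \<le> 0 then vector_derivative f (at t within {..0}) else 0"
        "\<lambda>t. vector_derivative f (at t within {..0})"]
    by (auto simp: C1_left_def)
  done

lemma c1_incl_inject: "c1_incl x = c1_incl y \<longleftrightarrow> x = y"
  by (metis c1_incl.rep_eq c1map_apply_inject)

lemma c1_incl_add: "c1_incl (x + y) = c1_incl x + c1_incl y"
  by transfer simp

lemma c1_incl_scaleR: "c1_incl (r *\<^sub>R x) = r *\<^sub>R c1_incl x"
  by transfer simp

lemma c1_deriv_add: "c1_deriv (x + y) = c1_deriv x + c1_deriv y"
  by transfer
    (auto simp: fun_eq_iff intro!: vector_derivative_left has_vector_derivative_add C1_leftD)

lemma c1_deriv_scaleR: "c1_deriv (r *\<^sub>R x) = r *\<^sub>R c1_deriv x"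
  by transfer
    (auto simp: fun_eq_iff intro!: vector_derivative_left C1_leftD
      bounded_linear.has_vector_derivative[OF bounded_linear_scaleR_right])

text \<open>Locally uniform convergence of maps and of their derivatives: the initial topology with
  respect to the map taking \<open>\<phi>\<close> to the pair of \<open>\<phi>\<close> and its derivative in \<open>C \<times> C\<close>.\<close>

instantiation c1map :: (real_normed_vector) topological_space
begin

definition open_c1map :: "'a c1map set \<Rightarrow> bool" where
  "open_c1map S \<longleftrightarrow> (\<exists>T. open T \<and> S = (\<lambda>x. (c1_incl x, c1_deriv x)) -` T)"

instance
proof
  show "open (UNIV :: 'a c1map set)"
    unfolding open_c1map_def by (intro exI[of _ UNIV]) simp
next
  fix S T :: "'a c1map set" assume "open S" "open T"
  then obtain S' T' where "open S'" "S = (\<lambda>x. (c1_incl x, c1_deriv x)) -` S'"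
      "open T'" "T = (\<lambda>x. (c1_incl x, c1_deriv x)) -` T'"
    unfolding open_c1map_def by auto
  then show "open (S \<inter> T)"
    unfolding open_c1map_def by (intro exI[of _ "S' \<inter> T'"]) auto
next
  fix K :: "'a c1map set set" assume "\<forall>S\<in>K. open S"
  then obtain g where g: "\<forall>S\<in>K. open (g S) \<and> S = (\<lambda>x. (c1_incl x, c1_deriv x)) -` g S"
    unfolding open_c1map_def by (auto dest: bchoice)
  then have "\<Union>K = (\<lambda>x. (c1_incl x, c1_deriv x)) -` (\<Union>S\<in>K. g S)" by blast
  moreover have "open (\<Union>S\<in>K. g S)" using g by blast
  ultimately show "open (\<Union>K)"
    unfolding open_c1map_def by (intro exI[of _ "\<Union>S\<in>K. g S"]) simp
qed

end

lemma tendsto_c1map_iff: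
  "(f \<longlongrightarrow> x) F \<longleftrightarrow>
     ((\<lambda>s. c1_incl (f s)) \<longlongrightarrow> c1_incl x) F \<and> ((\<lambda>s. c1_deriv (f s)) \<longlongrightarrow> c1_deriv x) F"
    (is "?L \<longleftrightarrow> ?R")
proof -
  let ?j = "\<lambda>x. (c1_incl x, c1_deriv x)"
  have "?L \<longleftrightarrow> ((\<lambda>s. ?j (f s)) \<longlongrightarrow> ?j x) F"
    unfolding tendsto_def open_c1map_def by auto
  also have "\<dots> \<longleftrightarrow> ?R"
    by (auto intro: tendsto_Pair dest: tendsto_fst tendsto_snd)
  finally show ?thesis .
qed

instance c1map :: (real_normed_vector) t2_space
proof
  fix x y :: "'a c1map" assume "x \<noteq> y"
  then have "c1_incl x \<noteq> c1_incl y" by (simp add: c1_incl_inject)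
  then obtain S T where ST: "open S" "open T" "c1_incl x \<in> S" "c1_incl y \<in> T" "S \<inter> T = {}"
    using hausdorff by metis
  have *: "open (c1_incl -` A)" if "open A" for A :: "'a cmap set"
    unfolding open_c1map_def using that open_Times[OF that open_UNIV]
    by (intro exI[of _ "A \<times> UNIV"]) auto
  show "\<exists>S T. open S \<and> open T \<and> x \<in> S \<and> y \<in> T \<and> S \<inter> T = {}"
    using ST by (intro exI[of _ "c1_incl -` S"] exI[of _ "c1_incl -` T"]) (auto intro: *)
qed

lemma tendsto_scaleR_c1map:
  fixes f :: "'s \<Rightarrow> 'a::real_normed_vector c1map"
  assumes "(a \<longlongrightarrow> b) F" "(f \<longlongrightarrow> x) F"
  shows "((\<lambda>s. a s *\<^sub>R f s) \<longlongrightarrow> b *\<^sub>R x) F"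
  using assms unfolding tendsto_c1map_iff c1_incl_scaleR c1_deriv_scaleR
  by (auto intro: tendsto_scaleR_cmap)

instance c1map :: (real_normed_vector) real_tvs
proof
  fix a b :: "'a c1map"
  have "((\<lambda>x. fst x) \<longlongrightarrow> a) (nhds a \<times>\<^sub>F nhds b)" "((\<lambda>x. snd x) \<longlongrightarrow> b) (nhds a \<times>\<^sub>F nhds b)"
    by (rule filterlim_fst filterlim_snd)+
  then show "((\<lambda>x. fst x + snd x) \<longlongrightarrow> a + b) (nhds a \<times>\<^sub>F nhds b)"
    unfolding tendsto_c1map_iff c1_incl_add c1_deriv_add by (auto intro: tendsto_add_cmap)
  show "(uminus \<longlongrightarrow> - a) (nhds a)"
    using tendsto_scaleR_c1map[OF tendsto_const[of "-1"] filterlim_ident[of "nhds a"]] by simp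
next
  fix a :: real and x :: "'a c1map"
  show "((\<lambda>p. fst p *\<^sub>R snd p) \<longlongrightarrow> a *\<^sub>R x) (nhds a \<times>\<^sub>F nhds x)"
    by (intro tendsto_scaleR_c1map filterlim_fst filterlim_snd)
qed


section \<open>Property (e) and the solution manifold\<close>

definition property_e ::
    "(real^'n) c1map set \<Rightarrow> ((real^'n) c1map \<Rightarrow> real^'n) \<Rightarrow> bool" where
  "property_e U f \<longleftrightarrow>
     (\<exists>De :: (real^'n) c1map \<Rightarrow> (real^'n) cmap \<Rightarrow> real^'n.
        (\<forall>\<phi>\<in>U. linear (De \<phi>) \<and> (\<forall>\<psi>. De \<phi> (c1_incl \<psi>) = DF f \<phi> \<psi>)) \<and>
        continuous_on (U \<times> UNIV) (\<lambda>(\<phi>, \<psi>). De \<phi> \<psi>))"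

definition solution_manifold ::
    "(real^'n) c1map set \<Rightarrow> ((real^'n) c1map \<Rightarrow> real^'n) \<Rightarrow> (real^'n) c1map set" where
  "solution_manifold U f = {\<phi> \<in> U. cmap_apply (c1_deriv \<phi>) 0 = f \<phi>}"

end

theory Submission
  imports Defs
begin

text \<open>Near \<open>\<phi> \<in> X\<^sub>f\<close> the manifold is straightened by \<open>K \<phi> = \<phi> - \<theta> (f \<phi>)\<close>, where
  \<open>\<theta> v\<close> is the function \<open>t \<mapsto> t exp(k t) v\<close>. As \<open>(\<theta> v)'(0) = v\<close>, we have
  \<open>(K \<phi>)'(0) = \<phi>'(0) - f \<phi>\<close>, so \<open>K\<close> maps \<open>X\<^sub>f\<close> into the fixed space
  \<open>G = {\<zeta>. \<zeta>'(0) = 0}\<close> of codimension \<open>n\<close>. For large \<open>k\<close> the function \<open>\<theta> v\<close> is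
  uniformly small, hence property (e) makes \<open>v \<mapsto> f (\<psi> + \<theta> v)\<close> a contraction in
  \<open>\<real>\<^sup>n\<close>, and its fixed points provide the inverse \<open>J \<psi> = \<psi> + \<theta> v\<close> of \<open>K\<close>: no
  inverse function theorem in Frechet spaces is needed. The inclusion of the tangent space in
  \<open>{\<zeta>. \<zeta>'(0) = Df(\<phi>) \<zeta>}\<close> is the chain rule for curves, and the curves
  \<open>t \<mapsto> J (K \<phi> + t DK(\<phi>) \<zeta>)\<close> give the converse.\<close>

section \<open>Topological vector spaces and the topology beta\<close>

lemma tendsto_scaleR_tvs:
  fixes f :: "'s \<Rightarrow> 'a::real_tvs"
  assumes "(a \<longlongrightarrow> b) F" "(f \<longlongrightarrow> x) F"
  shows "((\<lambda>s. a s *\<^sub>R f s) \<longlongrightarrow> b *\<^sub>R x) F"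
  using filterlim_compose[OF tendsto_scaleR_nhds filterlim_Pair[OF assms]] by simp

lemma continuous_on_scaleR_tvs:
  fixes f :: "'s::topological_space \<Rightarrow> 'a::real_tvs"
  shows "continuous_on S a \<Longrightarrow> continuous_on S f \<Longrightarrow> continuous_on S (\<lambda>s. a s *\<^sub>R f s)"
  unfolding continuous_on_def by (auto intro: tendsto_scaleR_tvs)

lemma continuous_on_UNIV_tendsto:
  assumes "continuous_on UNIV f" "(g \<longlongrightarrow> x) F"
  shows "((\<lambda>s. f (g s)) \<longlongrightarrow> f x) F"
  using assms by (auto intro: continuous_on_tendsto_compose)

text \<open>Expanding \<open>v\<close> in the finite basis leaves a finite sum of coordinates times
  fixed vectors, so continuity of the vector space operations suffices.\<close>

lemma linear_euclidean_continuous_on: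
  fixes T :: "'b::euclidean_space \<Rightarrow> 'a::real_tvs"
  assumes "linear T"
  shows "continuous_on A T"
proof -
  have "T = (\<lambda>v. \<Sum>b\<in>Basis. (v \<bullet> b) *\<^sub>R T b)"
  proof
    fix v
    have "T v = T (\<Sum>b\<in>Basis. (v \<bullet> b) *\<^sub>R b)"
      by (simp add: euclidean_representation)
    then show "T v = (\<Sum>b\<in>Basis. (v \<bullet> b) *\<^sub>R T b)"
      by (simp add: linear_sum[OF assms] linear_cmul[OF assms])
  qed
  moreover have "continuous_on A (\<lambda>v. \<Sum>b\<in>Basis. (v \<bullet> b) *\<^sub>R T b)"
    by (intro continuous_on_sum continuous_on_scaleR_tvs continuous_intros)
  ultimately show ?thesis by metis
qed

text \<open>Supplies the segments along which the mean value inequality is applied. Joint continuity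
  of scalar multiplication at zero stands in for local convexity, which \<open>real_tvs\<close> does
  not assume.\<close>

lemma eventually_segment:
  fixes h :: "'s \<Rightarrow> 'a::real_tvs"
  assumes "(h \<longlongrightarrow> 0) F" "eventually (\<lambda>x. x \<in> S) (nhds u)"
  shows "eventually (\<lambda>t. \<forall>s\<in>{0..1}. u + s *\<^sub>R h t \<in> S) F"
proof -
  have "((\<lambda>p. u + fst p *\<^sub>R snd p) \<longlongrightarrow> u + 0 *\<^sub>R 0) (nhds 0 \<times>\<^sub>F nhds (0::'a))"
    by (intro tendsto_add tendsto_const tendsto_scaleR_nhds)
  then have "((\<lambda>p. u + fst p *\<^sub>R snd p) \<longlongrightarrow> u) (nhds 0 \<times>\<^sub>F nhds (0::'a))" by simp
  then have "eventually (\<lambda>p. u + fst p *\<^sub>R snd p \<in> S) (nhds 0 \<times>\<^sub>F nhds (0::'a))"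
    by (rule eventually_compose_filterlim[OF assms(2)])
  then obtain P Q where PQ: "eventually P (nhds (0::real))" "eventually Q (nhds (0::'a))"
      "\<And>r x. P r \<Longrightarrow> Q x \<Longrightarrow> u + r *\<^sub>R x \<in> S"
    unfolding eventually_prod_filter by auto
  obtain d where d: "d > 0" "\<And>r. \<bar>r\<bar> < d \<Longrightarrow> P r"
    using PQ(1) unfolding eventually_nhds_metric by auto
  \<comment> \<open>Continuity at zero only covers scalars below \<open>d\<close>. Moving the factor
    \<open>2 / d\<close> onto \<open>h t\<close> turns \<open>s\<close> in the unit interval into
    \<open>s * d / 2\<close>, which is below \<open>d\<close>.\<close>
  have "((\<lambda>t. (2 / d) *\<^sub>R h t) \<longlongrightarrow> (2 / d) *\<^sub>R 0) F"
    by (intro tendsto_scaleR_tvs tendsto_const assms(1))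
  then have "eventually (\<lambda>t. Q ((2 / d) *\<^sub>R h t)) F"
    using PQ(2) unfolding filterlim_iff by simp
  then show ?thesis
  proof (rule eventually_mono, intro ballI)
    fix t and s :: real assume "Q ((2 / d) *\<^sub>R h t)" "s \<in> {0..1}"
    then have "u + (s * d / 2) *\<^sub>R ((2 / d) *\<^sub>R h t) \<in> S"
      using d by (intro PQ(3)) (auto intro: mult_le_less_imp_less simp: abs_mult less_le_trans)
    then show "u + s *\<^sub>R h t \<in> S" using d(1) by simp
  qed
qed

section \<open>Bounded sets and continuity with respect to \<open>beta\<close>\<close>

lemma tvs_bounded_linear_image:
  fixes T :: "'a::real_tvs \<Rightarrow> 'b::real_tvs"
  assumes "T \<in> Lc" "tvs_bounded B"
  shows "tvs_bounded (T ` B)"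
  unfolding tvs_bounded_def
proof (intro allI impI)
  fix N :: "'b set" assume N: "open N \<and> 0 \<in> N"
  have T: "linear T" "continuous_on UNIV T" using assms(1) unfolding Lc_def by auto
  have "open (T -` N)" "0 \<in> T -` N"
    using N T by (auto simp: open_vimage linear_0)
  then obtain r where r: "r > 0" "\<forall>s\<ge>r. B \<subseteq> (\<lambda>x. s *\<^sub>R x) ` (T -` N)"
    using assms(2) unfolding tvs_bounded_def by blast
  have "T ` B \<subseteq> (\<lambda>x. s *\<^sub>R x) ` N" if "s \<ge> r" for s :: real
  proof
    fix y assume "y \<in> T ` B"
    then obtain z where z: "T z \<in> N" "y = T (s *\<^sub>R z)" using r(2) \<open>s \<ge> r\<close> by blast
    then have "y = s *\<^sub>R T z" using linear_cmul[OF T(1)] by simp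
    with z(1) show "y \<in> (\<lambda>x. s *\<^sub>R x) ` N" by (intro image_eqI)
  qed
  then show "\<exists>r>0. \<forall>s\<ge>r. T ` B \<subseteq> (\<lambda>x. s *\<^sub>R x) ` N" using r(1) by blast
qed

text \<open>Lets continuity with respect to \<open>beta\<close> be used pointwise, for one fixed
  direction.\<close>

lemma tvs_bounded_singleton:
  fixes x :: "'a::real_tvs"
  shows "tvs_bounded {x}"
  unfolding tvs_bounded_def
proof (intro allI impI)
  fix N :: "'a set" assume N: "open N \<and> 0 \<in> N"
  have "((\<lambda>s::real. inverse s *\<^sub>R x) \<longlongrightarrow> 0 *\<^sub>R x) at_top"
    by (intro tendsto_scaleR_tvs tendsto_inverse_0_at_top filterlim_ident tendsto_const)
  then have "eventually (\<lambda>s::real. inverse s *\<^sub>R x \<in> N) at_top"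
    using N by (auto dest: topological_tendstoD)
  then obtain r where r: "\<And>s. s \<ge> r \<Longrightarrow> inverse s *\<^sub>R x \<in> N"
    unfolding eventually_at_top_linorder by blast
  have "x \<in> (\<lambda>x. s *\<^sub>R x) ` N" if "s \<ge> max r 1" for s
    using r[of s] that by (intro image_eqI[of _ _ "inverse s *\<^sub>R x"]) auto
  then show "\<exists>r>0. \<forall>s\<ge>r. {x} \<subseteq> (\<lambda>x. s *\<^sub>R x) ` N"
    by (intro exI[of _ "max r 1"]) auto
qed

lemma open_nhd_zero_halves:
  fixes N :: "'a::real_tvs set"
  assumes "open N" "0 \<in> N"
  obtains N' where "open N'" "0 \<in> N'" "\<And>x y. x \<in> N' \<Longrightarrow> y \<in> N' \<Longrightarrow> x + y \<in> N"
proof -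
  have "((\<lambda>p. fst p + snd p) \<longlongrightarrow> (0::'a) + 0) (nhds 0 \<times>\<^sub>F nhds 0)"
    by (intro tendsto_add filterlim_fst filterlim_snd)
  then have "eventually (\<lambda>p. fst p + snd p \<in> N) (nhds (0::'a) \<times>\<^sub>F nhds 0)"
    using assms by (auto dest: topological_tendstoD)
  then obtain P Q where PQ: "eventually P (nhds (0::'a))" "eventually Q (nhds (0::'a))"
      "\<And>x y. P x \<Longrightarrow> Q y \<Longrightarrow> x + y \<in> N"
    unfolding eventually_prod_filter by auto
  obtain A where A: "open A" "0 \<in> A" "\<forall>x\<in>A. P x \<and> Q x"
    using eventually_conj[OF PQ(1,2)] unfolding eventually_nhds by blast
  show ?thesis using that[OF A(1,2)] A(3) PQ(3) by blast
qed

text \<open>The basic sets in \<^const>\<open>beta_open\<close> need not be open; \<open>V\<close> is the interior.\<close>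

lemma beta_basic_nhd:
  fixes A :: "'a::real_tvs \<Rightarrow> 'b::real_tvs"
  assumes "A \<in> Lc" "tvs_bounded B" "open N" "0 \<in> N"
  obtains V where "openin beta V" "A \<in> V" "\<And>A' x. A' \<in> V \<Longrightarrow> x \<in> B \<Longrightarrow> A' x - A x \<in> N"
proof -
  define bas :: "('a \<Rightarrow> 'b) \<Rightarrow> 'a set \<Rightarrow> 'b set \<Rightarrow> ('a \<Rightarrow> 'b) set" where
    "bas = (\<lambda>A B N. {A' \<in> Lc. (\<lambda>x. A' x - A x) ` B \<subseteq> N})"
  define V where "V = {A1 \<in> Lc. \<exists>B' N'. tvs_bounded B' \<and> open N' \<and> 0 \<in> N' \<and> bas A1 B' N' \<subseteq> bas A B N}"
  have "beta_open V"
    unfolding beta_open_def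
  proof (intro conjI ballI)
    show "V \<subseteq> Lc" unfolding V_def by blast
  next
    fix A1 assume "A1 \<in> V"
    then obtain B' N' where 1: "tvs_bounded B'" "open N'" "0 \<in> N'" "bas A1 B' N' \<subseteq> bas A B N"
      unfolding V_def by blast
    \<comment> \<open>Deviations add up: \<open>A3\<close> within \<open>N2\<close> of
      \<open>A2\<close>, itself within \<open>N2\<close> of \<open>A1\<close>, is within
      \<open>N'\<close> of \<open>A1\<close> on \<open>B'\<close>. So every \<open>A2\<close> near
      \<open>A1\<close> again has a basic set inside \<open>bas A B N\<close>.\<close>
    obtain N2 where N2: "open N2" "0 \<in> N2" "\<And>x y. x \<in> N2 \<Longrightarrow> y \<in> N2 \<Longrightarrow> x + y \<in> N'"
      using open_nhd_zero_halves[OF 1(2,3)] by blast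
    have "A2 \<in> V" if "A2 \<in> bas A1 B' N2" for A2
    proof -
      have "A3 \<in> bas A1 B' N'" if "A3 \<in> bas A2 B' N2" for A3
      proof -
        have "A3 x - A1 x \<in> N'" if "x \<in> B'" for x
          using N2(3)[of "A3 x - A2 x" "A2 x - A1 x"] that \<open>A2 \<in> bas A1 B' N2\<close> \<open>A3 \<in> bas A2 B' N2\<close>
          unfolding bas_def by auto
        then show ?thesis using that unfolding bas_def by auto
      qed
      then have "bas A2 B' N2 \<subseteq> bas A B N" using 1(4) by blast
      moreover have "A2 \<in> Lc" using that unfolding bas_def by blast
      ultimately show ?thesis unfolding V_def using 1(1) N2(1,2) by blast
    qed
    then show "\<exists>B N. tvs_bounded B \<and> open N \<and> 0 \<in> N \<and> {A' \<in> Lc. (\<lambda>x. A' x - A1 x) ` B \<subseteq> N} \<subseteq> V"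
      using 1(1) N2(1,2) unfolding bas_def by blast
  qed
  then have 1: "openin beta V" by (simp add: openin_beta)
  have 2: "A \<in> V" unfolding V_def using assms by auto
  have "V \<subseteq> bas A B N"
  proof
    fix A' assume "A' \<in> V"
    then obtain B' N' where "A' \<in> Lc" "0 \<in> N'" "bas A' B' N' \<subseteq> bas A B N" unfolding V_def by blast
    moreover have "A' \<in> bas A' B' N'" using calculation(1,2) unfolding bas_def by auto
    ultimately show "A' \<in> bas A B N" by blast
  qed
  then show ?thesis using that[OF 1 2] unfolding bas_def by blast
qed

lemma open_iff_eventually_nhds: "open S \<longleftrightarrow> (\<forall>x\<in>S. eventually (\<lambda>y. y \<in> S) (nhds x))"
  unfolding eventually_nhds by (subst open_subopen) (simp add: subset_iff Ball_def)

text \<open>Brings continuity into \<open>beta\<close> to the form used below, an estimate holding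
  eventually and uniformly on one bounded set; \<open>continuous_map_betaI\<close> is the
  converse.\<close>

lemma continuous_map_betaD:
  assumes "continuous_map (top_of_set U) beta g" "open U" "u \<in> U"
    and "tvs_bounded B" "open N" "0 \<in> N"
  shows "eventually (\<lambda>x. \<forall>b\<in>B. g x b - g u b \<in> N) (nhds u)"
proof -
  have "g u \<in> Lc" using assms(1,3) unfolding continuous_map topspace_beta by auto
  then obtain V where V: "openin beta V" "g u \<in> V" "\<And>A' x. A' \<in> V \<Longrightarrow> x \<in> B \<Longrightarrow> A' x - g u x \<in> N"
    using beta_basic_nhd[OF _ assms(4-6)] by blast
  have "openin (top_of_set U) {x \<in> topspace (top_of_set U). g x \<in> V}"
    using assms(1) V(1) by (rule openin_continuous_map_preimage)
  then have "open {x \<in> U. g x \<in> V}" using assms(2) by (simp add: openin_open_eq)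
  then have "eventually (\<lambda>x. x \<in> {x \<in> U. g x \<in> V}) (nhds u)"
    using assms(3) V(2) by (intro eventually_nhds_in_open) auto
  then show ?thesis by (rule eventually_mono) (use V(3) in auto)
qed

lemma continuous_map_betaI:
  fixes g :: "'s::topological_space \<Rightarrow> 'a::real_tvs \<Rightarrow> 'b::real_tvs"
  assumes "open U" "\<And>u. u \<in> U \<Longrightarrow> g u \<in> Lc"
    and "\<And>u B N. u \<in> U \<Longrightarrow> tvs_bounded B \<Longrightarrow> open N \<Longrightarrow> 0 \<in> N \<Longrightarrow>
      eventually (\<lambda>x. \<forall>b\<in>B. g x b - g u b \<in> N) (nhds u)"
  shows "continuous_map (top_of_set U) beta g"
  unfolding continuous_map
proof (intro conjI allI impI)
  show "g ` topspace (top_of_set U) \<subseteq> topspace beta"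
    using assms(2) by (auto simp: topspace_beta)
next
  fix S :: "('a \<Rightarrow> 'b) set" assume "openin beta S"
  then have S: "beta_open S" by (simp add: openin_beta)
  have "eventually (\<lambda>x. x \<in> {x \<in> U. g x \<in> S}) (nhds u)" if u: "u \<in> U" "g u \<in> S" for u
  proof -
    obtain B N where BN: "tvs_bounded B" "open N" "0 \<in> N"
        "{A' \<in> Lc. (\<lambda>x. A' x - g u x) ` B \<subseteq> N} \<subseteq> S"
      using S u(2) unfolding beta_open_def by blast
    have "eventually (\<lambda>x. x \<in> U \<and> (\<forall>b\<in>B. g x b - g u b \<in> N)) (nhds u)"
      by (intro eventually_conj eventually_nhds_in_open assms(1) assms(3) u(1) BN(1-3))
    then show ?thesis by (rule eventually_mono) (use BN(4) assms(2) in auto)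
  qed
  then have "open {x \<in> U. g x \<in> S}"
    unfolding open_iff_eventually_nhds by blast
  then show "openin (top_of_set U) {x \<in> topspace (top_of_set U). g x \<in> S}"
    by (simp add: openin_open_eq[OF assms(1)])
qed

section \<open>Directional derivatives\<close>

lemma DF_eqI: "has_dir_deriv f u v l \<Longrightarrow> DF f u v = l"
  unfolding DF_def has_dir_deriv_def
  by (rule the_equality) (auto dest: tendsto_unique[rotated])

lemma C1F_onD:
  assumes "C1F_on U f" "u \<in> U"
  shows "has_dir_deriv f u v (DF f u v)" "linear (DF f u)" "DF f u \<in> Lc"
proof -
  obtain l where "has_dir_deriv f u v l" using assms unfolding C1F_on_def by blast
  then show "has_dir_deriv f u v (DF f u v)" using DF_eqI by metis
qed (use assms in \<open>auto simp: C1F_on_def Lc_def\<close>)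

lemma C1F_on_subset:
  assumes "C1F_on U f" "open N" "N \<subseteq> U"
  shows "C1F_on N f"
proof -
  have "continuous_map (top_of_set N) beta (DF f)"
    using assms unfolding C1F_on_def by (meson continuous_map_from_subtopology_mono)
  then show ?thesis
    using assms unfolding C1F_on_def by (auto intro: continuous_on_subset)
qed

lemma C1F_on_DF_eventually:
  fixes f :: "'a::real_tvs \<Rightarrow> 'b::real_normed_vector"
  assumes "C1F_on U f" "u \<in> U" "tvs_bounded B" "e > 0"
  shows "eventually (\<lambda>x. \<forall>b\<in>B. norm (DF f x b - DF f u b) < e) (nhds u)"
proof -
  have "eventually (\<lambda>x. \<forall>b\<in>B. DF f x b - DF f u b \<in> ball 0 e) (nhds u)"
    using assms unfolding C1F_on_def by (intro continuous_map_betaD) auto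
  then show ?thesis by simp
qed

lemma C1F_onI:
  assumes "open U" "continuous_on U f"
    and der: "\<And>u v. u \<in> U \<Longrightarrow> has_dir_deriv f u v (D u v)"
    and Lc: "\<And>u. u \<in> U \<Longrightarrow> D u \<in> Lc"
    and beta: "\<And>u B N. u \<in> U \<Longrightarrow> tvs_bounded B \<Longrightarrow> open N \<Longrightarrow> 0 \<in> N \<Longrightarrow>
      eventually (\<lambda>x. \<forall>b\<in>B. D x b - D u b \<in> N) (nhds u)"
  shows "C1F_on U f"
proof -
  have eq: "DF f u = D u" if "u \<in> U" for u using DF_eqI[OF der[OF that]] by blast
  have "continuous_map (top_of_set U) beta D"
    by (rule continuous_map_betaI[OF assms(1) Lc beta])
  then have "continuous_map (top_of_set U) beta (DF f)"
    by (rule continuous_map_eq) (simp add: eq)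
  then show ?thesis
    unfolding C1F_on_def using assms(1,2) der Lc by (auto simp: eq Lc_def)
qed

section \<open>Reduction to one real variable and the mean value inequality\<close>

text \<open>Along the line through \<open>u\<close> in direction \<open>h\<close>, the ordinary
  difference quotient at \<open>s\<close> is the directional one at the shifted base point.\<close>

lemma has_dir_deriv_vector_derivative:
  fixes f :: "'a::real_tvs \<Rightarrow> 'b::real_normed_vector"
  assumes "has_dir_deriv f (u + s *\<^sub>R h) h l"
  shows "((\<lambda>s. f (u + s *\<^sub>R h)) has_vector_derivative l) (at s)"
proof -
  have *: "((\<lambda>t. (1 / t) *\<^sub>R (f (u + s *\<^sub>R h + t *\<^sub>R h) - f (u + s *\<^sub>R h)) - l) \<longlongrightarrow> 0) (at 0)"
    using assms unfolding has_dir_deriv_def by (subst LIM_zero_iff)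
  have "((\<lambda>t. norm (f (u + (s + t) *\<^sub>R h) - f (u + s *\<^sub>R h) - t *\<^sub>R l) / norm t) \<longlongrightarrow> 0) (at 0)"
  proof (rule Lim_transform_eventually[OF tendsto_norm_zero[OF *]])
    have "norm ((1 / t) *\<^sub>R (f (u + s *\<^sub>R h + t *\<^sub>R h) - f (u + s *\<^sub>R h)) - l) =
        norm (f (u + (s + t) *\<^sub>R h) - f (u + s *\<^sub>R h) - t *\<^sub>R l) / norm t" if "t \<noteq> 0" for t
    proof -
      let ?d = "f (u + (s + t) *\<^sub>R h) - f (u + s *\<^sub>R h)"
      have "(1 / t) *\<^sub>R ?d - l = (1 / t) *\<^sub>R (?d - t *\<^sub>R l)"
        using that by (simp add: scaleR_right_diff_distrib)
      then show ?thesis by (simp add: scaleR_add_left add.assoc)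
    qed
    then show "eventually (\<lambda>t. norm ((1 / t) *\<^sub>R (f (u + s *\<^sub>R h + t *\<^sub>R h) - f (u + s *\<^sub>R h)) - l) =
        norm (f (u + (s + t) *\<^sub>R h) - f (u + s *\<^sub>R h) - t *\<^sub>R l) / norm t) (at 0)"
      by (simp add: eventually_at_filter)
  qed
  then show ?thesis
    unfolding has_vector_derivative_def has_derivative_at by (simp add: bounded_linear_scaleR_left)
qed

text \<open>The reference value \<open>c\<close> serves two uses: zero gives Lipschitz bounds, the
  expected increment gives differentiability.\<close>

lemma C1F_mean_value:
  fixes f :: "'a::real_tvs \<Rightarrow> 'b::real_normed_vector"
  assumes "C1F_on U f" "\<And>s. s \<in> {0..1} \<Longrightarrow> u + s *\<^sub>R h \<in> U"
    and M: "\<And>s. s \<in> {0..1} \<Longrightarrow> norm (DF f (u + s *\<^sub>R h) h - c) \<le> M"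
  shows "norm (f (u + h) - f u - c) \<le> M"
proof -
  let ?g = "\<lambda>s. f (u + s *\<^sub>R h) - s *\<^sub>R c"
  have "norm (?g 1 - ?g 0) \<le> M * norm (1 - 0 :: real)"
  proof (rule differentiable_bound)
    fix s :: real assume s: "s \<in> {0..1}"
    have "((\<lambda>s. f (u + s *\<^sub>R h)) has_vector_derivative DF f (u + s *\<^sub>R h) h) (at s within {0..1})"
      by (rule has_vector_derivative_at_within[OF has_dir_deriv_vector_derivative])
        (rule C1F_onD(1)[OF assms(1) assms(2)[OF s]])
    then have "(?g has_vector_derivative (DF f (u + s *\<^sub>R h) h - c)) (at s within {0..1})"
      by (auto intro!: derivative_eq_intros)
    then show "(?g has_derivative (\<lambda>t. t *\<^sub>R (DF f (u + s *\<^sub>R h) h - c))) (at s within {0..1})"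
      unfolding has_vector_derivative_def .
    show "onorm (\<lambda>t. t *\<^sub>R (DF f (u + s *\<^sub>R h) h - c)) \<le> M"
      using M[OF s] by (simp add: onorm_scaleR_left bounded_linear_ident onorm_id)
  qed auto
  then show ?thesis by (simp add: algebra_simps)
qed

section \<open>Perturbing the identity by a map of finite rank\<close>

text \<open>\<open>\<theta>\<close> factors the perturbation through the finite-dimensional
  \<open>'b\<close>, where Banach's fixed point theorem applies. Convexity of \<open>N\<close> keeps
  segments between its points inside, as the mean value inequality requires.\<close>

locale finite_rank_perturbation =
  fixes N :: "'a::real_tvs set" and f :: "'a \<Rightarrow> 'b::euclidean_space" and \<theta> :: "'b \<Rightarrow> 'a"
  assumes smooth: "C1F_on N f"
    and convex_N: "convex N"
    and linear_theta: "linear \<theta>"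
    and contraction: "\<And>\<phi> w. \<phi> \<in> N \<Longrightarrow> norm (DF f \<phi> (\<theta> w)) \<le> norm w / 2"
begin

definition K :: "'a \<Rightarrow> 'a" where "K \<phi> = \<phi> - \<theta> (f \<phi>)"

definition J :: "'a \<Rightarrow> 'a" where "J = inv_into N K"

text \<open>The derivative of \<open>K\<close> at \<open>\<phi>\<close>, as
  \<open>has_dir_deriv_K\<close> shows.\<close>

definition T :: "'a \<Rightarrow> 'a \<Rightarrow> 'a" where "T \<phi> \<eta> = \<eta> - \<theta> (DF f \<phi> \<eta>)"

lemmas theta_simps = linear_0[OF linear_theta] linear_add[OF linear_theta]
  linear_diff[OF linear_theta] linear_cmul[OF linear_theta]

lemma open_N: "open N"
  using smooth unfolding C1F_on_def by blast

lemma tendsto_theta: "(g \<longlongrightarrow> v) F \<Longrightarrow> ((\<lambda>s. \<theta> (g s)) \<longlongrightarrow> \<theta> v) F"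
  by (rule continuous_on_UNIV_tendsto[OF linear_euclidean_continuous_on[OF linear_theta]])

lemma tendsto_f: "\<phi> \<in> N \<Longrightarrow> (g \<longlongrightarrow> \<phi>) F \<Longrightarrow> ((\<lambda>s. f (g s)) \<longlongrightarrow> f \<phi>) F"
  using smooth open_N unfolding C1F_on_def
  by (metis continuous_on_eq_continuous_at isCont_tendsto_compose)

lemma tendsto_DF: "\<phi> \<in> N \<Longrightarrow> (g \<longlongrightarrow> v) F \<Longrightarrow> ((\<lambda>s. DF f \<phi> (g s)) \<longlongrightarrow> DF f \<phi> v) F"
  using smooth unfolding C1F_on_def by (blast intro: continuous_on_UNIV_tendsto)

section \<open>The fixed point problem behind \<open>K\<close> and its inverse\<close>

lemma segment_in_N:
  assumes "\<phi> \<in> N" "\<phi> + h \<in> N" "s \<in> {0..1}"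
  shows "\<phi> + s *\<^sub>R h \<in> N"
proof -
  have "(1 - s) *\<^sub>R \<phi> + s *\<^sub>R (\<phi> + h) \<in> N"
    using convexD_alt[OF convex_N assms(1,2)] assms(3) by simp
  then show ?thesis by (simp add: algebra_simps)
qed

text \<open>Passing from \<open>w\<close> to \<open>v\<close> moves the argument in the direction
  \<open>\<theta> (v - w)\<close>, in which \<open>contraction\<close> bounds the derivative on the
  whole segment.\<close>

lemma f_contraction:
  assumes "\<phi> + \<theta> v \<in> N" "\<phi> + \<theta> w \<in> N"
  shows "norm (f (\<phi> + \<theta> v) - f (\<phi> + \<theta> w)) \<le> norm (v - w) / 2"
proof -
  have *: "\<phi> + \<theta> w + \<theta> (v - w) = \<phi> + \<theta> v" by (simp add: theta_simps)
  have "norm (f (\<phi> + \<theta> w + \<theta> (v - w)) - f (\<phi> + \<theta> w) - 0) \<le> norm (v - w) / 2"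
  proof (rule C1F_mean_value[OF smooth])
    fix s :: real assume "s \<in> {0..1}"
    then show "\<phi> + \<theta> w + s *\<^sub>R \<theta> (v - w) \<in> N"
      using segment_in_N[of "\<phi> + \<theta> w" "\<theta> (v - w)" s] assms * by simp
    then show "norm (DF f (\<phi> + \<theta> w + s *\<^sub>R \<theta> (v - w)) (\<theta> (v - w)) - 0) \<le> norm (v - w) / 2"
      using contraction by simp
  qed
  then show ?thesis by (simp add: *)
qed

lemma inj_on_K: "inj_on K N"
proof (rule inj_onI)
  fix \<phi> \<phi>' assume *: "\<phi> \<in> N" "\<phi>' \<in> N" "K \<phi> = K \<phi>'"
  let ?\<psi> = "K \<phi>"
  have eq: "\<phi> = ?\<psi> + \<theta> (f \<phi>)" "\<phi>' = ?\<psi> + \<theta> (f \<phi>')"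
    using *(3) unfolding K_def by (simp_all add: algebra_simps)
  \<comment> \<open>Both \<open>f \<phi>\<close> and \<open>f \<phi>'\<close> are fixed points of
    \<open>\<lambda>v. f (?\<psi> + \<theta> v)\<close>.\<close>
  have "norm (f \<phi> - f \<phi>') \<le> norm (f \<phi> - f \<phi>') / 2"
    using f_contraction[of ?\<psi> "f \<phi>" "f \<phi>'"] * eq by metis
  then have "f \<phi> = f \<phi>'" by simp
  then show "\<phi> = \<phi>'" using eq by metis
qed

lemma
  assumes "\<psi> \<in> K ` N"
  shows J_in_N: "J \<psi> \<in> N" and K_J: "K (J \<psi>) = \<psi>" and J_fixpoint: "J \<psi> = \<psi> + \<theta> (f (J \<psi>))"
proof -
  show "J \<psi> \<in> N" using assms unfolding J_def by (rule inv_into_into)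
  show "K (J \<psi>) = \<psi>" using assms unfolding J_def by (rule f_inv_into_f)
  then show "J \<psi> = \<psi> + \<theta> (f (J \<psi>))" unfolding K_def by (simp add: algebra_simps)
qed

text \<open>Reduces estimates for \<open>J\<close> to estimates for
  \<open>f \<circ> J\<close>.\<close>

lemma J_diff:
  assumes "\<psi> \<in> K ` N" "\<psi>' \<in> K ` N"
  shows "J \<psi>' - J \<psi> = \<psi>' - \<psi> + \<theta> (f (J \<psi>') - f (J \<psi>))"
  using J_fixpoint[OF assms(1)] J_fixpoint[OF assms(2)] by (metis add_diff_add theta_simps(3))

lemma J_K: "\<phi> \<in> N \<Longrightarrow> J (K \<phi>) = \<phi>"
  unfolding J_def by (rule inv_into_f_f[OF inj_on_K])

text \<open>A point \<open>\<psi>\<close> is a value of \<open>K\<close> as soon as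
  \<open>\<lambda>v. f (\<psi> + \<theta> v)\<close> has a fixed point \<open>v\<close> with
  \<open>\<psi> + \<theta> v\<close> in \<open>N\<close>. For \<open>\<psi>\<close> near
  \<open>\<psi>0\<close> this map is a contraction of one closed ball around
  \<open>v0\<close>.\<close>

lemma open_image_K: "open (K ` N)"
  unfolding open_iff_eventually_nhds
proof
  fix \<psi>0 assume "\<psi>0 \<in> K ` N"
  then obtain \<phi>0 where \<phi>0: "\<phi>0 \<in> N" "\<psi>0 = K \<phi>0" by blast
  define v0 where "v0 = f \<phi>0"
  have eq: "\<psi>0 + \<theta> v0 = \<phi>0" unfolding \<phi>0(2) K_def v0_def by simp
  have "((\<lambda>p. fst p + \<theta> (snd p)) \<longlongrightarrow> \<psi>0 + \<theta> v0) (nhds \<psi>0 \<times>\<^sub>F nhds v0)"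
    by (intro tendsto_add tendsto_theta filterlim_fst filterlim_snd)
  then have "eventually (\<lambda>p. fst p + \<theta> (snd p) \<in> N) (nhds \<psi>0 \<times>\<^sub>F nhds v0)"
    using open_N \<phi>0(1) eq by (auto dest: topological_tendstoD)
  then obtain P Q where PQ: "eventually P (nhds \<psi>0)" "eventually Q (nhds v0)"
      "\<And>x y. P x \<Longrightarrow> Q y \<Longrightarrow> x + \<theta> y \<in> N"
    unfolding eventually_prod_filter by auto
  obtain d where d: "d > 0" "\<And>v. dist v v0 < d \<Longrightarrow> Q v"
    using PQ(2) unfolding eventually_nhds_metric by blast
  define r where "r = d / 2"
  have r: "r > 0" "\<And>\<psi> v. P \<psi> \<Longrightarrow> v \<in> cball v0 r \<Longrightarrow> \<psi> + \<theta> v \<in> N"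
    using d PQ(3) unfolding r_def by (auto simp: dist_commute)
  have "((\<lambda>\<psi>. f (\<psi> + \<theta> v0)) \<longlongrightarrow> f (\<psi>0 + \<theta> v0)) (nhds \<psi>0)"
    using \<phi>0(1) eq by (intro tendsto_f tendsto_add filterlim_ident tendsto_const) simp
  then have "((\<lambda>\<psi>. f (\<psi> + \<theta> v0)) \<longlongrightarrow> v0) (nhds \<psi>0)" by (simp add: eq flip: v0_def)
  then have "eventually (\<lambda>\<psi>. dist (f (\<psi> + \<theta> v0)) v0 < r / 2) (nhds \<psi>0)"
    using r(1) by (intro tendstoD) auto
  with PQ(1) have "eventually (\<lambda>\<psi>. P \<psi> \<and> dist (f (\<psi> + \<theta> v0)) v0 < r / 2) (nhds \<psi>0)"
    by (rule eventually_conj)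
  then show "eventually (\<lambda>\<psi>. \<psi> \<in> K ` N) (nhds \<psi>0)"
  proof (rule eventually_mono)
    fix \<psi> assume \<psi>: "P \<psi> \<and> dist (f (\<psi> + \<theta> v0)) v0 < r / 2"
    let ?F = "\<lambda>v. f (\<psi> + \<theta> v)"
    have lip: "dist (?F v) (?F w) \<le> 1 / 2 * dist v w" if "v \<in> cball v0 r" "w \<in> cball v0 r" for v w
      using f_contraction[of \<psi> v w] r(2) \<psi> that by (simp add: dist_norm)
    \<comment> \<open>The centre moves by less than \<open>r / 2\<close>, and the Lipschitz constant
      adds at most another \<open>r / 2\<close>.\<close>
    have "?F ` cball v0 r \<subseteq> cball v0 r"
    proof
      fix y assume "y \<in> ?F ` cball v0 r"
      then obtain v where v: "y = ?F v" "v \<in> cball v0 r" by blast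
      have "dist v0 (?F v) \<le> dist v0 (?F v0) + dist (?F v0) (?F v)" by (rule dist_triangle)
      also have "\<dots> \<le> r / 2 + 1 / 2 * r"
        using \<psi> lip[of v0 v] v(2) r(1) by (intro add_mono) (auto simp: dist_commute)
      finally show "y \<in> cball v0 r" by (simp add: v(1))
    qed
    then obtain v where v: "v \<in> cball v0 r" "?F v = v"
      using Banach_fix[of "cball v0 r" "1/2" ?F] lip r(1) by (auto simp: complete_eq_closed)
    then have "\<psi> = K (\<psi> + \<theta> v)" unfolding K_def by simp
    then show "\<psi> \<in> K ` N" using r(2) \<psi> v(1) by blast
  qed
qed

text \<open>The distance from \<open>v0\<close> to the fixed point \<open>f (J \<psi>)\<close> is at
  most twice the displacement of \<open>v0\<close> under
  \<open>\<lambda>v. f (\<psi> + \<theta> v)\<close>, and this displacement tends to zero.\<close>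

lemma tendsto_J:
  assumes "\<psi>0 \<in> K ` N"
  shows "(J \<longlongrightarrow> J \<psi>0) (nhds \<psi>0)"
proof -
  define v0 where "v0 = f (J \<psi>0)"
  have eq: "\<psi>0 + \<theta> v0 = J \<psi>0" using J_fixpoint[OF assms] unfolding v0_def by simp
  have 1: "((\<lambda>\<psi>. \<psi> + \<theta> v0) \<longlongrightarrow> J \<psi>0) (nhds \<psi>0)"
    unfolding eq[symmetric] by (intro tendsto_add filterlim_ident tendsto_const)
  then have 2: "((\<lambda>\<psi>. f (\<psi> + \<theta> v0)) \<longlongrightarrow> v0) (nhds \<psi>0)"
    unfolding v0_def by (intro tendsto_f J_in_N assms)
  have "eventually (\<lambda>\<psi>. \<psi> + \<theta> v0 \<in> N) (nhds \<psi>0)"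
    using 1 open_N J_in_N[OF assms] by (rule topological_tendstoD)
  moreover have "eventually (\<lambda>\<psi>. \<psi> \<in> K ` N) (nhds \<psi>0)"
    using open_image_K assms by (rule eventually_nhds_in_open)
  ultimately have ev: "eventually (\<lambda>\<psi>. norm (f (J \<psi>) - v0) \<le> norm (f (\<psi> + \<theta> v0) - v0) * 2) (nhds \<psi>0)"
  proof eventually_elim
    case (elim \<psi>)
    have "norm (f (J \<psi>) - f (\<psi> + \<theta> v0)) \<le> norm (f (J \<psi>) - v0) / 2"
      using f_contraction[of \<psi> "f (J \<psi>)" v0] elim J_in_N J_fixpoint by metis
    moreover have "norm (f (J \<psi>) - v0) \<le> norm (f (J \<psi>) - f (\<psi> + \<theta> v0)) + norm (f (\<psi> + \<theta> v0) - v0)"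
      using norm_triangle_ineq[of "f (J \<psi>) - f (\<psi> + \<theta> v0)" "f (\<psi> + \<theta> v0) - v0"] by simp
    ultimately show ?case by linarith
  qed
  have "((\<lambda>\<psi>. f (J \<psi>) - v0) \<longlongrightarrow> 0) (nhds \<psi>0)"
    by (rule Lim_null_comparison[OF ev tendsto_mult_left_zero[OF tendsto_norm_zero[OF LIM_zero[OF 2]]]])
  then have "((\<lambda>\<psi>. f (J \<psi>)) \<longlongrightarrow> v0) (nhds \<psi>0)" by (rule LIM_zero_cancel)
  then have "((\<lambda>\<psi>. \<psi> + \<theta> (f (J \<psi>))) \<longlongrightarrow> J \<psi>0) (nhds \<psi>0)"
    unfolding eq[symmetric] by (intro tendsto_add tendsto_theta filterlim_ident)
  then show ?thesis
  proof (rule Lim_transform_eventually)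
    show "eventually (\<lambda>\<psi>. \<psi> + \<theta> (f (J \<psi>)) = J \<psi>) (nhds \<psi>0)"
      using eventually_nhds_in_open[OF open_image_K assms]
      by (rule eventually_mono) (metis J_fixpoint)
  qed
qed

section \<open>Inverting the linearised map \<open>T \<phi>\<close>\<close>

lemma linear_T: "\<phi> \<in> N \<Longrightarrow> linear (T \<phi>)"
  using C1F_onD(2)[OF smooth]
  by (intro linearI) (auto simp: T_def theta_simps linear_add linear_cmul algebra_simps)

lemma tendsto_T: "\<phi> \<in> N \<Longrightarrow> (g \<longlongrightarrow> v) F \<Longrightarrow> ((\<lambda>s. T \<phi> (g s)) \<longlongrightarrow> T \<phi> v) F"
  unfolding T_def by (intro tendsto_diff tendsto_theta tendsto_DF)

lemma T_Lc: "\<phi> \<in> N \<Longrightarrow> T \<phi> \<in> Lc"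
  unfolding Lc_def continuous_on_def using linear_T by (auto intro: tendsto_T)

text \<open>The linear version of the same fixed point problem:
  \<open>\<eta> = \<zeta> + \<theta> w\<close> solves \<open>T \<phi> \<eta> = \<zeta>\<close> when
  \<open>w = DF f \<phi> (\<zeta> + \<theta> w)\<close>. Here the contraction acts on the whole
  space \<open>'b\<close>.\<close>

lemma bij_T:
  assumes "\<phi> \<in> N"
  shows "bij (T \<phi>)"
proof (rule bijI)
  have lin: "linear (DF f \<phi>)" by (rule C1F_onD(2)[OF smooth assms])
  have "\<eta> = 0" if "T \<phi> \<eta> = 0" for \<eta>
  proof -
    have eq: "\<eta> = \<theta> (DF f \<phi> \<eta>)" using that unfolding T_def by simp
    then have "norm (DF f \<phi> \<eta>) \<le> norm (DF f \<phi> \<eta>) / 2" using contraction[OF assms] by metis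
    then have "DF f \<phi> \<eta> = 0" by simp
    then show ?thesis using eq by (simp add: theta_simps)
  qed
  then show "inj (T \<phi>)" using linear_injective_0[OF linear_T[OF assms]] by blast
  show "surj (T \<phi>)"
    unfolding surj_def
  proof
    fix \<zeta>
    have lip: "dist (DF f \<phi> (\<zeta> + \<theta> v)) (DF f \<phi> (\<zeta> + \<theta> w)) \<le> 1 / 2 * dist v w" for v w
      using contraction[OF assms, of "v - w"]
      by (simp add: dist_norm linear_add[OF lin] linear_diff[OF lin] theta_simps)
    obtain w where w: "DF f \<phi> (\<zeta> + \<theta> w) = w"
      using banach_fix_type[of "1/2" "\<lambda>w. DF f \<phi> (\<zeta> + \<theta> w)"] lip by auto
    then have "\<zeta> = T \<phi> (\<zeta> + \<theta> w)" unfolding T_def by simp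
    then show "\<exists>\<eta>. \<zeta> = T \<phi> \<eta>" ..
  qed
qed

lemma T_inv_T: "\<phi> \<in> N \<Longrightarrow> T \<phi> (inv (T \<phi>) \<zeta>) = \<zeta>"
  using bij_T by (meson bij_is_surj surj_f_inv_f)

lemma inv_T_T: "\<phi> \<in> N \<Longrightarrow> inv (T \<phi>) (T \<phi> \<eta>) = \<eta>"
  using bij_T by (meson bij_is_inj inv_f_f)

lemma inv_T_fixpoint: "\<phi> \<in> N \<Longrightarrow> inv (T \<phi>) \<zeta> = \<zeta> + \<theta> (DF f \<phi> (inv (T \<phi>) \<zeta>))"
  using T_inv_T[of \<phi> \<zeta>] unfolding T_def by (simp add: algebra_simps)

lemma linear_inv_T:
  assumes "\<phi> \<in> N"
  shows "linear (inv (T \<phi>))"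
proof (rule linearI)
  note T = linear_T[OF assms]
  show "inv (T \<phi>) (x + y) = inv (T \<phi>) x + inv (T \<phi>) y" for x y
    using inv_T_T[OF assms, of "inv (T \<phi>) x + inv (T \<phi>) y"]
    by (simp add: linear_add[OF T] T_inv_T[OF assms])
  show "inv (T \<phi>) (c *\<^sub>R x) = c *\<^sub>R inv (T \<phi>) x" for c x
    using inv_T_T[OF assms, of "c *\<^sub>R inv (T \<phi>) x"]
    by (simp add: linear_cmul[OF T] T_inv_T[OF assms])
qed

text \<open>Applying \<open>DF f \<phi>\<close> to \<open>inv_T_fixpoint\<close> and absorbing the
  half from \<open>contraction\<close> gives the factor two. This bound yields continuity of the
  inverse without an open mapping theorem.\<close>

lemma norm_DF_inv_T_le:
  assumes "\<phi> \<in> N"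
  shows "norm (DF f \<phi> (inv (T \<phi>) \<zeta>)) \<le> 2 * norm (DF f \<phi> \<zeta>)"
proof -
  let ?w = "DF f \<phi> (inv (T \<phi>) \<zeta>)"
  have "?w = DF f \<phi> \<zeta> + DF f \<phi> (\<theta> ?w)"
    using inv_T_fixpoint[OF assms, of \<zeta>] linear_add[OF C1F_onD(2)[OF smooth assms]] by metis
  then have "norm ?w \<le> norm (DF f \<phi> \<zeta>) + norm (DF f \<phi> (\<theta> ?w))"
    using norm_triangle_ineq by metis
  then show ?thesis using contraction[OF assms, of ?w] by linarith
qed

text \<open>By \<open>inv_T_fixpoint\<close> it is enough that the finite-dimensional part
  \<open>DF f \<phi> (inv (T \<phi>) x)\<close> depends continuously on \<open>x\<close>; it is
  linear, so \<open>norm_DF_inv_T_le\<close> is applied to differences.\<close>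

lemma inv_T_Lc:
  assumes "\<phi> \<in> N"
  shows "inv (T \<phi>) \<in> Lc"
proof -
  note lin = C1F_onD(2)[OF smooth assms]
  have "(inv (T \<phi>) \<longlongrightarrow> inv (T \<phi>) \<zeta>) (at \<zeta>)" for \<zeta>
  proof -
    have le: "norm (DF f \<phi> (inv (T \<phi>) x) - DF f \<phi> (inv (T \<phi>) \<zeta>)) \<le> norm (DF f \<phi> x - DF f \<phi> \<zeta>) * 2" for x
      using norm_DF_inv_T_le[OF assms, of "x - \<zeta>"]
      by (simp add: linear_diff[OF lin] linear_diff[OF linear_inv_T[OF assms]])
    have "((\<lambda>x. DF f \<phi> x) \<longlongrightarrow> DF f \<phi> \<zeta>) (at \<zeta>)"
      by (intro tendsto_DF assms tendsto_ident_at)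
    then have "((\<lambda>x. norm (DF f \<phi> x - DF f \<phi> \<zeta>) * 2) \<longlongrightarrow> 0) (at \<zeta>)"
      by (intro tendsto_mult_left_zero tendsto_norm_zero LIM_zero)
    with always_eventually[OF allI[OF le]]
    have "((\<lambda>x. DF f \<phi> (inv (T \<phi>) x) - DF f \<phi> (inv (T \<phi>) \<zeta>)) \<longlongrightarrow> 0) (at \<zeta>)"
      by (rule Lim_null_comparison)
    then have "((\<lambda>x. DF f \<phi> (inv (T \<phi>) x)) \<longlongrightarrow> DF f \<phi> (inv (T \<phi>) \<zeta>)) (at \<zeta>)"
      by (rule LIM_zero_cancel)
    then have "((\<lambda>x. x + \<theta> (DF f \<phi> (inv (T \<phi>) x))) \<longlongrightarrow> \<zeta> + \<theta> (DF f \<phi> (inv (T \<phi>) \<zeta>))) (at \<zeta>)"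
      by (intro tendsto_add tendsto_theta tendsto_ident_at)
    then show ?thesis by (simp flip: inv_T_fixpoint[OF assms])
  qed
  then show ?thesis unfolding Lc_def continuous_on_def using linear_inv_T[OF assms] by simp
qed

section \<open>Smoothness of \<open>K\<close> and of its inverse\<close>

lemma has_dir_deriv_K:
  assumes "\<phi> \<in> N"
  shows "has_dir_deriv K \<phi> \<eta> (T \<phi> \<eta>)"
proof -
  have "((\<lambda>t. (1 / t) *\<^sub>R (f (\<phi> + t *\<^sub>R \<eta>) - f \<phi>)) \<longlongrightarrow> DF f \<phi> \<eta>) (at 0)"
    using C1F_onD(1)[OF smooth assms] unfolding has_dir_deriv_def .
  then have "((\<lambda>t. \<eta> - \<theta> ((1 / t) *\<^sub>R (f (\<phi> + t *\<^sub>R \<eta>) - f \<phi>))) \<longlongrightarrow> T \<phi> \<eta>) (at 0)"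
    unfolding T_def by (intro tendsto_diff tendsto_const tendsto_theta)
  then show ?thesis
    unfolding has_dir_deriv_def
    by (rule Lim_transform_eventually)
      (auto simp: eventually_at_filter K_def theta_simps algebra_simps scaleR_diff_right)
qed

lemma C1F_on_K: "C1F_on N K"
proof (rule C1F_onI[OF open_N _ has_dir_deriv_K T_Lc])
  show "continuous_on N K"
    unfolding K_def continuous_on_def by (auto intro!: tendsto_diff tendsto_theta tendsto_f tendsto_ident_at)
next
  fix \<phi> :: 'a and B M :: "'a set" assume *: "\<phi> \<in> N" "tvs_bounded B" "open M" "0 \<in> M"
  \<comment> \<open>\<open>T x b - T \<phi> b\<close> is \<open>\<theta>\<close> of the negated
    change of the derivative, so continuity of \<open>\<theta>\<close> at zero replaces
    \<open>M\<close> by a norm bound.\<close>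
  have "((\<lambda>v. \<theta> (- v)) \<longlongrightarrow> 0) (nhds 0)"
    using tendsto_theta[OF tendsto_minus[OF filterlim_ident[of "nhds 0"]]] by (simp add: theta_simps)
  then have "eventually (\<lambda>v. \<theta> (- v) \<in> M) (nhds 0)"
    using *(3,4) by (rule topological_tendstoD)
  then obtain e where e: "e > 0" "\<And>v. norm v < e \<Longrightarrow> \<theta> (- v) \<in> M"
    unfolding eventually_nhds_metric by auto
  show "eventually (\<lambda>x. \<forall>b\<in>B. T x b - T \<phi> b \<in> M) (nhds \<phi>)"
    using C1F_on_DF_eventually[OF smooth *(1,2) e(1)]
  proof (rule eventually_mono, intro ballI)
    fix x b assume "\<forall>b\<in>B. norm (DF f x b - DF f \<phi> b) < e" "b \<in> B"
    then have "\<theta> (- (DF f x b - DF f \<phi> b)) \<in> M" using e(2) by blast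
    then show "T x b - T \<phi> b \<in> M" unfolding T_def by (simp add: theta_simps)
  qed
qed

text \<open>With \<open>\<eta>\<close> the expected derivative, the increment of \<open>f \<circ> J\<close> minus \<open>t *\<^sub>R DF f \<phi> \<eta>\<close> is
  estimated by half of itself plus \<open>o(t)\<close>.\<close>

lemma has_dir_deriv_J:
  assumes "\<psi> \<in> K ` N"
  shows "has_dir_deriv J \<psi> \<zeta> (inv (T (J \<psi>)) \<zeta>)"
proof -
  define \<phi> where "\<phi> = J \<psi>"
  have \<phi>: "\<phi> \<in> N" unfolding \<phi>_def by (rule J_in_N[OF assms])
  define \<eta> where "\<eta> = inv (T \<phi>) \<zeta>"
  have \<eta>: "\<zeta> = \<eta> - \<theta> (DF f \<phi> \<eta>)" using T_inv_T[OF \<phi>, of \<zeta>] unfolding \<eta>_def T_def by simp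
  \<comment> \<open>The difference quotient of \<open>f \<circ> J\<close> along
    \<open>\<zeta>\<close>; by \<open>J_diff\<close> that of \<open>J\<close> is
    \<open>\<zeta> + \<theta> (q t)\<close>, so it remains to find the limit of
    \<open>q\<close>.\<close>
  define q where "q t = (1 / t) *\<^sub>R (f (J (\<psi> + t *\<^sub>R \<zeta>)) - f \<phi>)" for t
  have path: "((\<lambda>t. \<psi> + t *\<^sub>R \<zeta>) \<longlongrightarrow> \<psi>) (at 0)"
  proof -
    have "((\<lambda>t. \<psi> + t *\<^sub>R \<zeta>) \<longlongrightarrow> \<psi> + 0 *\<^sub>R \<zeta>) (at 0)"
      by (intro tendsto_add tendsto_const tendsto_scaleR_tvs tendsto_ident_at)
    then show ?thesis by simp
  qed
  have Jpath: "((\<lambda>t. J (\<psi> + t *\<^sub>R \<zeta>)) \<longlongrightarrow> \<phi>) (at 0)"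
    unfolding \<phi>_def by (rule filterlim_compose[OF tendsto_J[OF assms] path])
  have "(q \<longlongrightarrow> DF f \<phi> \<eta>) (at 0)"
  proof (rule tendstoI)
    fix e :: real assume e: "e > 0"
    \<comment> \<open>A quarter: absorbing \<open>norm d / 2\<close> doubles \<open>E\<close> to
      \<open>e / 2\<close>, which leaves a strict inequality.\<close>
    define E where "E = e / 4"
    \<comment> \<open>Closeness of derivatives is asked in the fixed direction \<open>\<eta>\<close>
      alone; the remaining part \<open>\<theta> d\<close> of the increment is controlled by
      \<open>contraction\<close> throughout \<open>N\<close>.\<close>
    define S where "S = {x \<in> N. norm (DF f x \<eta> - DF f \<phi> \<eta>) < E}"
    have "eventually (\<lambda>x. x \<in> S) (nhds \<phi>)"
      unfolding S_def mem_Collect_eq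
      using C1F_on_DF_eventually[OF smooth \<phi> tvs_bounded_singleton[of \<eta>], of E] e
      by (intro eventually_conj eventually_nhds_in_open open_N \<phi>) (auto simp: E_def)
    then have "eventually (\<lambda>t. \<forall>s\<in>{0..1}. \<phi> + s *\<^sub>R (J (\<psi> + t *\<^sub>R \<zeta>) - \<phi>) \<in> S) (at 0)"
      using tendsto_diff[OF Jpath tendsto_const[of \<phi>]] by (intro eventually_segment) auto
    moreover have "eventually (\<lambda>t. \<psi> + t *\<^sub>R \<zeta> \<in> K ` N) (at 0)"
      using path open_image_K assms by (rule topological_tendstoD)
    moreover have "eventually (\<lambda>t::real. t \<noteq> 0) (at 0)" by (simp add: eventually_at_filter)
    ultimately show "eventually (\<lambda>t. dist (q t) (DF f \<phi> \<eta>) < e) (at 0)"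
    proof eventually_elim
      case (elim t)
      define \<Delta> where "\<Delta> = f (J (\<psi> + t *\<^sub>R \<zeta>)) - f \<phi>"
      define h where "h = J (\<psi> + t *\<^sub>R \<zeta>) - \<phi>"
      define d where "d = \<Delta> - t *\<^sub>R DF f \<phi> \<eta>"
      have "h = t *\<^sub>R \<zeta> + \<theta> \<Delta>"
        using J_diff[OF assms elim(2)] unfolding h_def \<Delta>_def \<phi>_def by simp
      \<comment> \<open>Inserting \<open>\<zeta> = \<eta> - \<theta> (DF f \<phi> \<eta>)\<close>
        splits the increment into the expected part and \<open>\<theta>\<close> of the error
        \<open>d\<close>.\<close>
      then have h: "h = t *\<^sub>R \<eta> + \<theta> d"
        unfolding d_def \<eta> by (simp add: theta_simps algebra_simps)
      have "norm (f (\<phi> + h) - f \<phi> - t *\<^sub>R DF f \<phi> \<eta>) \<le> \<bar>t\<bar> * E + norm d / 2"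
      proof (rule C1F_mean_value[OF smooth])
        fix s :: real assume "s \<in> {0..1}"
        then have x: "\<phi> + s *\<^sub>R h \<in> S" using elim(1) unfolding h_def by blast
        define x where "x = \<phi> + s *\<^sub>R h"
        have xN: "x \<in> N" and E: "norm (DF f x \<eta> - DF f \<phi> \<eta>) < E"
          using x unfolding x_def S_def by auto
        show "\<phi> + s *\<^sub>R h \<in> N" using xN unfolding x_def .
        note lin = C1F_onD(2)[OF smooth xN]
        have "DF f x h - t *\<^sub>R DF f \<phi> \<eta> = t *\<^sub>R (DF f x \<eta> - DF f \<phi> \<eta>) + DF f x (\<theta> d)"
          unfolding h by (simp add: linear_add[OF lin] linear_cmul[OF lin] algebra_simps)
        then have "norm (DF f x h - t *\<^sub>R DF f \<phi> \<eta>) \<le>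
            norm (t *\<^sub>R (DF f x \<eta> - DF f \<phi> \<eta>)) + norm (DF f x (\<theta> d))"
          by (metis norm_triangle_ineq)
        also have "\<dots> \<le> \<bar>t\<bar> * E + norm d / 2"
          using E contraction[OF xN] by (intro add_mono) (auto intro: mult_left_mono)
        finally show "norm (DF f (\<phi> + s *\<^sub>R h) h - t *\<^sub>R DF f \<phi> \<eta>) \<le> \<bar>t\<bar> * E + norm d / 2"
          unfolding x_def .
      qed
      then have "norm d \<le> \<bar>t\<bar> * E + norm d / 2" unfolding h_def d_def \<Delta>_def by simp
      then have "norm d \<le> \<bar>t\<bar> * (e / 2)" unfolding E_def by simp
      moreover have "q t - DF f \<phi> \<eta> = (1 / t) *\<^sub>R d"
        unfolding q_def d_def \<Delta>_def using elim(3) by (simp add: algebra_simps)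
      ultimately have "dist (q t) (DF f \<phi> \<eta>) \<le> e / 2"
        using elim(3) by (simp add: dist_norm field_simps)
      then show ?case using e by simp
    qed
  qed
  then have "((\<lambda>t. \<zeta> + \<theta> (q t)) \<longlongrightarrow> \<zeta> + \<theta> (DF f \<phi> \<eta>)) (at 0)"
    by (intro tendsto_add tendsto_const tendsto_theta)
  moreover have "\<zeta> + \<theta> (DF f \<phi> \<eta>) = inv (T (J \<psi>)) \<zeta>"
    using \<eta> unfolding \<eta>_def \<phi>_def by (simp add: algebra_simps)
  ultimately have lim: "((\<lambda>t. \<zeta> + \<theta> (q t)) \<longlongrightarrow> inv (T (J \<psi>)) \<zeta>) (at 0)" by simp
  show ?thesis
    unfolding has_dir_deriv_def
  proof (rule Lim_transform_eventually[OF lim])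
    have "eventually (\<lambda>t. \<psi> + t *\<^sub>R \<zeta> \<in> K ` N) (at 0)"
      using path open_image_K assms by (rule topological_tendstoD)
    moreover have "eventually (\<lambda>t::real. t \<noteq> 0) (at 0)" by (simp add: eventually_at_filter)
    ultimately show "eventually (\<lambda>t. \<zeta> + \<theta> (q t) = (1 / t) *\<^sub>R (J (\<psi> + t *\<^sub>R \<zeta>) - J \<psi>)) (at 0)"
    proof eventually_elim
      case (elim t)
      have "J (\<psi> + t *\<^sub>R \<zeta>) - J \<psi> = t *\<^sub>R \<zeta> + \<theta> (f (J (\<psi> + t *\<^sub>R \<zeta>)) - f \<phi>)"
        using J_diff[OF assms elim(1)] unfolding \<phi>_def by simp
      then show ?case
        unfolding q_def using elim(2) by (simp add: theta_simps scaleR_add_right)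
    qed
  qed
qed

text \<open>A resolvent-type comparison, again by absorbing a half. The bound involves only the
  inverse at the fixed point \<open>\<phi>\<close>, so for \<open>b\<close> in a bounded set the
  vectors \<open>inv (T \<phi>) b\<close> stay in a bounded set.\<close>

lemma inv_T_diff:
  assumes "x \<in> N" "\<phi> \<in> N"
  obtains d where "inv (T x) b - inv (T \<phi>) b = \<theta> d"
    and "norm d \<le> 2 * norm (DF f x (inv (T \<phi>) b) - DF f \<phi> (inv (T \<phi>) b))"
proof
  define d where "d = DF f x (inv (T x) b) - DF f \<phi> (inv (T \<phi>) b)"
  show eq: "inv (T x) b - inv (T \<phi>) b = \<theta> d"
    using inv_T_fixpoint[OF assms(1), of b] inv_T_fixpoint[OF assms(2), of b]
    unfolding d_def by (metis add_diff_cancel_left theta_simps(3))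
  note lin = C1F_onD(2)[OF smooth assms(1)]
  have "inv (T x) b = inv (T \<phi>) b + \<theta> d" using eq by (simp add: algebra_simps)
  then have "DF f x (inv (T x) b) = DF f x (inv (T \<phi>) b) + DF f x (\<theta> d)"
    by (metis linear_add[OF lin])
  then have "d = (DF f x (inv (T \<phi>) b) - DF f \<phi> (inv (T \<phi>) b)) + DF f x (\<theta> d)"
    by (simp add: d_def)
  then have "norm d \<le> norm (DF f x (inv (T \<phi>) b) - DF f \<phi> (inv (T \<phi>) b)) + norm (DF f x (\<theta> d))"
    by (metis norm_triangle_ineq)
  then show "norm d \<le> 2 * norm (DF f x (inv (T \<phi>) b) - DF f \<phi> (inv (T \<phi>) b))"
    using contraction[OF assms(1), of d] by linarith
qed

lemma C1F_on_J: "C1F_on (K ` N) J"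
proof (rule C1F_onI[OF open_image_K _ has_dir_deriv_J])
  show "continuous_on (K ` N) J"
    by (rule continuous_at_imp_continuous_on)
      (use tendsto_J in \<open>auto simp: isCont_def tendsto_at_iff_tendsto_nhds\<close>)
  show "inv (T (J \<psi>)) \<in> Lc" if "\<psi> \<in> K ` N" for \<psi> by (intro inv_T_Lc J_in_N that)
next
  fix \<psi> :: 'a and B M :: "'a set" assume *: "\<psi> \<in> K ` N" "tvs_bounded B" "open M" "0 \<in> M"
  define \<phi> where "\<phi> = J \<psi>"
  have \<phi>: "\<phi> \<in> N" unfolding \<phi>_def by (rule J_in_N[OF *(1)])
  have "(\<theta> \<longlongrightarrow> 0) (nhds 0)"
    using tendsto_theta[OF filterlim_ident[of "nhds 0"]] by (simp add: theta_simps)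
  then have "eventually (\<lambda>v. \<theta> v \<in> M) (nhds 0)"
    using *(3,4) by (rule topological_tendstoD)
  then obtain e where e: "e > 0" "\<And>v. norm v < e \<Longrightarrow> \<theta> v \<in> M"
    unfolding eventually_nhds_metric by auto
  have bdd: "tvs_bounded (inv (T \<phi>) ` B)"
    by (rule tvs_bounded_linear_image[OF inv_T_Lc[OF \<phi>] *(2)])
  \<comment> \<open>The bound \<open>e / 2\<close> offsets the factor two in
    \<open>inv_T_diff\<close>.\<close>
  have "eventually (\<lambda>x. \<forall>b\<in>inv (T \<phi>) ` B. norm (DF f x b - DF f \<phi> b) < e / 2) (nhds \<phi>)"
    using e(1) by (intro C1F_on_DF_eventually[OF smooth \<phi> bdd]) simp
  then have "eventually (\<lambda>y. \<forall>b\<in>inv (T \<phi>) ` B. norm (DF f (J y) b - DF f \<phi> b) < e / 2) (nhds \<psi>)"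
    using tendsto_J[OF *(1)] unfolding \<phi>_def filterlim_iff by blast
  moreover have "eventually (\<lambda>y. y \<in> K ` N) (nhds \<psi>)"
    using open_image_K *(1) by (rule eventually_nhds_in_open)
  ultimately show "eventually (\<lambda>y. \<forall>b\<in>B. inv (T (J y)) b - inv (T (J \<psi>)) b \<in> M) (nhds \<psi>)"
  proof eventually_elim
    case (elim y)
    show ?case
    proof
      fix b assume b: "b \<in> B"
      obtain d where d: "inv (T (J y)) b - inv (T \<phi>) b = \<theta> d"
          "norm d \<le> 2 * norm (DF f (J y) (inv (T \<phi>) b) - DF f \<phi> (inv (T \<phi>) b))"
        using inv_T_diff[OF J_in_N[OF elim(2)] \<phi>] by blast
      moreover have "norm (DF f (J y) (inv (T \<phi>) b) - DF f \<phi> (inv (T \<phi>) b)) < e / 2"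
        using elim(1) b by blast
      ultimately have "\<theta> d \<in> M" using e(2) by simp
      then show "inv (T (J y)) b - inv (T (J \<psi>)) b \<in> M" using d(1) unfolding \<phi>_def by simp
    qed
  qed
qed

theorem C1F_diffeomorphism_K: "C1F_diffeomorphism N (K ` N) K"
  unfolding C1F_diffeomorphism_def
  using open_N open_image_K inj_on_K C1F_on_K C1F_on_J unfolding J_def by simp

lemma DF_J: "\<psi> \<in> K ` N \<Longrightarrow> DF J \<psi> \<zeta> = inv (T (J \<psi>)) \<zeta>"
  by (rule DF_eqI[OF has_dir_deriv_J])

end

section \<open>The spaces of continuous and of continuously differentiable maps\<close>

lemma tendsto_cmap_apply:
  assumes "(g \<longlongrightarrow> x) F" "t \<le> 0"
  shows "((\<lambda>s. cmap_apply (g s) t) \<longlongrightarrow> cmap_apply x t) F"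
proof (rule tendstoI)
  fix e :: real assume "e > 0"
  then have "eventually (\<lambda>s. near (- t) e x (g s)) F"
    using assms(1) unfolding tendsto_cmap_iff by blast
  then show "eventually (\<lambda>s. dist (cmap_apply (g s) t) (cmap_apply x t) < e) F"
    by (rule eventually_mono) (use assms(2) in \<open>auto simp: near_def dist_norm\<close>)
qed

lemma continuous_on_c1_incl: "continuous_on A c1_incl"
  unfolding continuous_on_def
proof
  show "(c1_incl \<longlongrightarrow> c1_incl x) (at x within A)" for x :: "'a c1map"
    using tendsto_ident_at[of x A] unfolding tendsto_c1map_iff by blast
qed

lemma continuous_on_c1_deriv: "continuous_on A c1_deriv"
  unfolding continuous_on_def
proof
  show "(c1_deriv \<longlongrightarrow> c1_deriv x) (at x within A)" for x :: "'a c1map"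
    using tendsto_ident_at[of x A] unfolding tendsto_c1map_iff by blast
qed

lemma linear_c1_incl: "linear c1_incl"
  by (rule linearI) (simp_all add: c1_incl_add c1_incl_scaleR)

lemma linear_c1_deriv: "linear c1_deriv"
  by (rule linearI) (simp_all add: c1_deriv_add c1_deriv_scaleR)

section \<open>Local convexity of the two function spaces\<close>

lemma cmap_convex_nhd:
  fixes x :: "'a::real_normed_vector cmap"
  assumes "open S" "x \<in> S"
  obtains N where "open N" "convex N" "x \<in> N" "N \<subseteq> S"
proof -
  obtain k e where e: "e > 0" "\<And>y. near k e x y \<Longrightarrow> y \<in> S"
    using assms unfolding open_cmap_def by blast
  \<comment> \<open>The gap between \<open>d\<close> and \<open>e\<close> leaves room for openness,
    and closed balls make the condition visibly convex.\<close>
  define N where "N = {y. \<exists>d<e. \<forall>t\<in>{-k..0}. cmap_apply y t \<in> cball (cmap_apply x t) d}"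
  have "open N"
    unfolding open_iff_eventually_nhds
  proof
    fix y assume "y \<in> N"
    then obtain d where d: "d < e" "\<forall>t\<in>{-k..0}. cmap_apply y t \<in> cball (cmap_apply x t) d"
      unfolding N_def by blast
    have "eventually (near k ((e - d) / 2) y) (nhds y)"
      using d(1) by (intro eventually_nhds_near) simp
    then show "eventually (\<lambda>z. z \<in> N) (nhds y)"
    proof (rule eventually_mono)
      fix z assume z: "near k ((e - d) / 2) y z"
      have "cmap_apply z t \<in> cball (cmap_apply x t) ((e + d) / 2)" if t: "t \<in> {-k..0}" for t
      proof -
        have "dist (cmap_apply x t) (cmap_apply z t)
            \<le> dist (cmap_apply x t) (cmap_apply y t) + dist (cmap_apply z t) (cmap_apply y t)"
          by (rule dist_triangle2)
        also have "\<dots> \<le> d + (e - d) / 2"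
          using z d(2) t unfolding near_def by (intro add_mono) (auto simp: dist_norm less_imp_le)
        finally show ?thesis by (simp add: field_simps)
      qed
      then show "z \<in> N" unfolding N_def using d(1) by (intro CollectI exI[of _ "(e + d) / 2"]) auto
    qed
  qed
  moreover have "convex N"
  proof (rule convexI)
    fix y z and u v :: real assume *: "y \<in> N" "z \<in> N" "0 \<le> u" "0 \<le> v" "u + v = 1"
    obtain d where d: "d < e" "\<forall>t\<in>{-k..0}. cmap_apply y t \<in> cball (cmap_apply x t) d"
      using *(1) unfolding N_def by blast
    obtain d' where d': "d' < e" "\<forall>t\<in>{-k..0}. cmap_apply z t \<in> cball (cmap_apply x t) d'"
      using *(2) unfolding N_def by blast
    have "cmap_apply (u *\<^sub>R y + v *\<^sub>R z) t \<in> cball (cmap_apply x t) (max d d')" if "t \<in> {-k..0}" for t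
      unfolding plus_cmap.rep_eq scaleR_cmap.rep_eq
      using d(2) d'(2) that *(3-5) by (intro convexD[OF convex_cball]) fastforce+
    then show "u *\<^sub>R y + v *\<^sub>R z \<in> N"
      unfolding N_def using d(1) d'(1) by (intro CollectI exI[of _ "max d d'"]) auto
  qed
  moreover have "x \<in> N" unfolding N_def using e(1) by (intro CollectI exI[of _ 0]) auto
  moreover have "N \<subseteq> S"
  proof
    fix y assume "y \<in> N"
    then obtain d where "d < e" "\<forall>t\<in>{-k..0}. cmap_apply y t \<in> cball (cmap_apply x t) d"
      unfolding N_def by blast
    then have "near k e x y"
      unfolding near_def by (metis dist_commute dist_norm le_less_trans mem_cball)
    then show "y \<in> S" by (rule e(2))
  qed
  ultimately show ?thesis using that by blast
qed

text \<open>The topology is initial for two linear maps into \<open>cmap\<close>, and linear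
  preimages of convex sets are convex. This supplies the convex domain that the locale
  requires.\<close>

lemma c1map_convex_nhd:
  fixes x :: "'a::real_normed_vector c1map"
  assumes "open S" "x \<in> S"
  obtains N where "open N" "convex N" "x \<in> N" "N \<subseteq> S"
proof -
  obtain R where R: "open R" "S = (\<lambda>x. (c1_incl x, c1_deriv x)) -` R"
    using assms(1) unfolding open_c1map_def by blast
  have "(c1_incl x, c1_deriv x) \<in> R" using assms(2) R(2) by simp
  then obtain A B where AB: "open A" "open B" "c1_incl x \<in> A" "c1_deriv x \<in> B" "A \<times> B \<subseteq> R"
    using open_prod_elim[OF R(1)] by (metis SigmaD1 SigmaD2)
  obtain A' where A': "open A'" "convex A'" "c1_incl x \<in> A'" "A' \<subseteq> A"
    using cmap_convex_nhd[OF AB(1,3)] .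
  obtain B' where B': "open B'" "convex B'" "c1_deriv x \<in> B'" "B' \<subseteq> B"
    using cmap_convex_nhd[OF AB(2,4)] .
  show ?thesis
  proof
    show "open (c1_incl -` A' \<inter> c1_deriv -` B')"
      using A'(1) B'(1)
      by (intro open_Int open_vimage continuous_on_c1_incl continuous_on_c1_deriv)
    show "convex (c1_incl -` A' \<inter> c1_deriv -` B')"
      using A'(2) B'(2)
      by (intro convex_Int convex_linear_vimage linear_c1_incl linear_c1_deriv)
    show "x \<in> c1_incl -` A' \<inter> c1_deriv -` B'" using A'(3) B'(3) by simp
    have "A' \<times> B' \<subseteq> R" using A'(4) B'(4) AB(5) by blast
    then show "c1_incl -` A' \<inter> c1_deriv -` B' \<subseteq> S" unfolding R(2) by auto
  qed
qed

section \<open>The derivative at zero, the bump functions and the splitting of the space\<close>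

definition deriv0 :: "'a::real_normed_vector c1map \<Rightarrow> 'a" where
  "deriv0 \<phi> = cmap_apply (c1_deriv \<phi>) 0"

lemma linear_deriv0: "linear deriv0"
  by (rule linearI)
    (simp_all add: deriv0_def c1_deriv_add c1_deriv_scaleR plus_cmap.rep_eq scaleR_cmap.rep_eq)

lemma continuous_on_deriv0: "continuous_on A deriv0"
  unfolding continuous_on_def deriv0_def
  using continuous_on_c1_deriv[of A] by (auto intro!: tendsto_cmap_apply simp: continuous_on_def)

lemma has_vector_derivative_exp_bump:
  "((\<lambda>t. if t \<le> 0 then (t * exp (k * t)) *\<^sub>R v else 0)
      has_vector_derivative ((1 + k * t) * exp (k * t)) *\<^sub>R v) (at t within {..0})"
  if "t \<le> (0::real)" for v :: "'a::real_normed_vector"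
proof (rule has_vector_derivative_transform)
  show "((\<lambda>t. (t * exp (k * t)) *\<^sub>R v) has_vector_derivative ((1 + k * t) * exp (k * t)) *\<^sub>R v) (at t within {..0})"
    by (auto intro!: derivative_eq_intros simp: algebra_simps)
qed (use that in auto)

text \<open>The map \<open>\<theta>\<close> of the construction; the zero branch reflects that
  \<open>c1map\<close> stores functions extended by zero.\<close>

lift_definition exp_bump :: "real \<Rightarrow> 'a::real_normed_vector \<Rightarrow> 'a c1map"
  is "\<lambda>k v t. if t \<le> 0 then (t * exp (k * t)) *\<^sub>R v else 0"
  by (auto intro!: C1_leftI[OF has_vector_derivative_exp_bump] continuous_intros)

lemma linear_exp_bump: "linear (exp_bump k)"
  by (rule linearI; transfer) (auto simp: algebra_simps fun_eq_iff)

lemma deriv0_exp_bump: "deriv0 (exp_bump k v) = v"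
  using vector_derivative_left[OF has_vector_derivative_exp_bump[of 0 k v]]
  by (simp add: deriv0_def c1_deriv.rep_eq exp_bump.rep_eq)

text \<open>Multiply \<open>k * \<bar>t\<bar> \<le> exp (k * \<bar>t\<bar>)\<close> by
  \<open>exp (k * t)\<close>. The bound is uniform in \<open>t\<close>, so for large
  \<open>k\<close> the function is small in \<open>cmap\<close> although \<open>deriv0\<close> of it
  remains \<open>v\<close>.\<close>

lemma norm_exp_bump_le:
  assumes "k > 0" "t \<le> 0"
  shows "norm (cmap_apply (c1_incl (exp_bump k v)) t) \<le> norm v / k"
proof -
  have "k * \<bar>t\<bar> \<le> exp (k * \<bar>t\<bar>)" using exp_ge_add_one_self[of "k * \<bar>t\<bar>"] by linarith
  then have "k * \<bar>t\<bar> * exp (k * t) \<le> exp (k * \<bar>t\<bar>) * exp (k * t)"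
    by (rule mult_right_mono) simp
  also have "\<dots> = 1" using assms(2) by (simp flip: exp_add)
  finally have "\<bar>t\<bar> * exp (k * t) \<le> 1 / k" using assms(1) by (simp add: field_simps)
  then have "\<bar>t\<bar> * exp (k * t) * norm v \<le> 1 / k * norm v" by (rule mult_right_mono) simp
  then show ?thesis using assms(2) by (simp add: c1_incl.rep_eq exp_bump.rep_eq abs_mult)
qed

text \<open>\<open>\<lambda>\<zeta>. exp_bump k (deriv0 \<zeta>)\<close> is a continuous projection
  whose kernel and range are the two summands; the range is closed as its set of fixed
  points.\<close>

lemma closed_direct_sum_exp_bump:
  "closed_direct_sum {\<zeta> :: 'a::euclidean_space c1map. deriv0 \<zeta> = 0} (range (exp_bump k))"
  unfolding closed_direct_sum_def
proof (intro conjI)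
  have cont: "continuous_on UNIV (\<lambda>\<zeta> :: 'a c1map. exp_bump k (deriv0 \<zeta>))"
    by (rule continuous_on_compose2[OF linear_euclidean_continuous_on[OF linear_exp_bump] continuous_on_deriv0]) auto
  have "range (exp_bump k) = {\<zeta> :: 'a c1map. exp_bump k (deriv0 \<zeta>) = \<zeta>}"
    by (auto simp: deriv0_exp_bump intro: range_eqI[OF sym])
  then show "closed (range (exp_bump k :: 'a \<Rightarrow> _))"
    by (simp add: closed_Collect_eq[OF cont continuous_on_id])
  show "closed {\<zeta> :: 'a c1map. deriv0 \<zeta> = 0}"
    by (intro closed_Collect_eq continuous_on_deriv0 continuous_on_const)
  show "subspace {\<zeta> :: 'a c1map. deriv0 \<zeta> = 0}"
    by (rule linear_subspace_kernel[OF linear_deriv0])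
  show "subspace (range (exp_bump k :: 'a \<Rightarrow> _))"
    by (rule linear_subspace_image[OF linear_exp_bump subspace_UNIV])
  show "{\<zeta> :: 'a c1map. deriv0 \<zeta> = 0} \<inter> range (exp_bump k) = {0}"
    using linear_0[OF linear_exp_bump[of k]] linear_0[OF linear_deriv0]
    by (auto simp: deriv0_exp_bump intro!: range_eqI[of _ _ 0])
  have "\<exists>g h. \<zeta> = g + h \<and> deriv0 g = 0 \<and> h \<in> range (exp_bump k)" for \<zeta> :: "'a c1map"
    by (rule exI[of _ "\<zeta> - exp_bump k (deriv0 \<zeta>)"], rule exI[of _ "exp_bump k (deriv0 \<zeta>)"])
      (simp add: linear_diff[OF linear_deriv0] deriv0_exp_bump)
  then show "{g + h |g h. g \<in> {\<zeta>. deriv0 \<zeta> = 0} \<and> h \<in> range (exp_bump k)} = (UNIV :: 'a c1map set)"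
    by auto
qed

lemma span_exp_bump_Basis: "span (exp_bump k ` Basis) = range (exp_bump k)"
  by (simp add: linear_span_image[OF linear_exp_bump])

lemma dim_range_exp_bump: "dim (range (exp_bump k :: 'a::euclidean_space \<Rightarrow> _)) = DIM('a)"
proof -
  let ?\<theta> = "exp_bump k :: 'a \<Rightarrow> 'a c1map"
  have inj: "inj ?\<theta>" by (rule inj_on_inverseI) (rule deriv0_exp_bump)
  have "independent (?\<theta> ` Basis)"
    by (rule linear_independent_injective_image[OF linear_exp_bump independent_Basis])
      (rule inj_on_subset[OF inj], simp)
  then have "dim (range ?\<theta>) = card (?\<theta> ` Basis)"
    by (metis dim_span_eq_card_independent span_exp_bump_Basis)
  also have "\<dots> = DIM('a)" by (rule card_image) (rule inj_on_subset[OF inj], simp)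
  finally show ?thesis .
qed

section \<open>The solution manifold\<close>

text \<open>The extended derivative is continuous at \<open>(\<phi>, 0)\<close> for the topology of
  \<open>cmap\<close> in the second argument, in which bumps with large \<open>k\<close> are small.
  So one \<open>k\<close> serves all \<open>x\<close> near \<open>\<phi>\<close>, and linearity
  turns a bound on a ball into the contraction estimate.\<close>

lemma property_e_small_exp_bump:
  fixes f :: "(real^'n) c1map \<Rightarrow> real^'n"
  assumes "open U" "property_e U f" "\<phi> \<in> U"
  obtains k N where "open N" "\<phi> \<in> N" "N \<subseteq> U" "convex N"
    "\<And>x w. x \<in> N \<Longrightarrow> norm (DF f x (exp_bump k w)) \<le> norm w / 2"
proof -
  obtain De :: "(real^'n) c1map \<Rightarrow> (real^'n) cmap \<Rightarrow> real^'n"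
    where lin: "\<And>x. x \<in> U \<Longrightarrow> linear (De x)"
      and ext: "\<And>x \<zeta>. x \<in> U \<Longrightarrow> De x (c1_incl \<zeta>) = DF f x \<zeta>"
      and cont: "continuous_on (U \<times> UNIV) (\<lambda>(x, \<zeta>). De x \<zeta>)"
    using assms(2) unfolding property_e_def by blast
  let ?F = "\<lambda>(x, \<zeta>). De x \<zeta>"
  define S where "S = ?F -` ball 0 1 \<inter> (U \<times> UNIV)"
  have "open (U \<times> (UNIV :: (real^'n) cmap set))" using assms(1) by (simp add: open_Times)
  then have "open S"
    unfolding S_def using continuous_on_open_vimage cont open_ball by blast
  moreover have "(\<phi>, 0) \<in> S"
    unfolding S_def using assms(3) linear_0[OF lin[OF assms(3)]] by simp
  ultimately obtain A B where AB: "open A" "open B" "\<phi> \<in> A" "0 \<in> B" "A \<times> B \<subseteq> S"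
    using open_prod_elim by (metis SigmaD1 SigmaD2)
  obtain j e where e: "e > 0" "\<And>y. near j e 0 y \<Longrightarrow> y \<in> B"
    using AB(2,4) unfolding open_cmap_def by blast
  obtain N where N: "open N" "convex N" "\<phi> \<in> N" "N \<subseteq> A"
    using c1map_convex_nhd[OF AB(1,3)] .
  have NU: "N \<subseteq> U" using N(4) AB(4,5) unfolding S_def by blast
  \<comment> \<open>For \<open>norm w \<le> 2\<close> the bump is bounded by \<open>2 / k\<close>,
    that is two thirds of \<open>e\<close>.\<close>
  define k where "k = 3 / e"
  have k: "k > 0" using e(1) unfolding k_def by simp
  show ?thesis
  proof (rule that[OF N(1,3) NU N(2)])
    fix x and w :: "real^'n" assume x: "x \<in> N"
    have lt: "norm (DF f x (exp_bump k w)) < 1" if "norm w \<le> 2" for w :: "real^'n"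
    proof -
      have "near j e 0 (c1_incl (exp_bump k w))"
        unfolding near_def
      proof
        fix t assume "t \<in> {-j..0}"
        then have "norm (cmap_apply (c1_incl (exp_bump k w)) t) \<le> norm w / k"
          by (intro norm_exp_bump_le[OF k]) simp
        also have "\<dots> \<le> 2 / k" using that k by (simp add: divide_right_mono)
        also have "\<dots> < e" using e(1) unfolding k_def by simp
        finally show "norm (cmap_apply (c1_incl (exp_bump k w)) t - cmap_apply 0 t) < e"
          by (simp add: zero_cmap.rep_eq)
      qed
      then have "(x, c1_incl (exp_bump k w)) \<in> S" using e(2) x N(4) AB(5) by blast
      then show ?thesis using ext x NU unfolding S_def by auto
    qed
    show "norm (DF f x (exp_bump k w)) \<le> norm w / 2"
    proof (cases "w = 0")
      case True
      have "x \<in> U" using x NU by blast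
      then have "DF f x 0 = 0"
        using ext[of x 0] by (simp add: linear_0[OF lin] linear_0[OF linear_c1_incl])
      then show ?thesis using True by (simp add: linear_0[OF linear_exp_bump])
    next
      case False
      \<comment> \<open>Rescales \<open>w\<close> to norm two, the radius treated in
        \<open>lt\<close>.\<close>
      define c where "c = norm w / 2"
      have c: "c > 0" using False unfolding c_def by simp
      have "w = c *\<^sub>R ((1 / c) *\<^sub>R w)" using c by simp
      then have "DF f x (exp_bump k w) = DF f x (c *\<^sub>R exp_bump k ((1 / c) *\<^sub>R w))"
        by (metis linear_cmul[OF linear_exp_bump])
      also have "\<dots> = c *\<^sub>R DF f x (exp_bump k ((1 / c) *\<^sub>R w))"
        using x NU linear_cmul[OF lin] by (metis c1_incl_scaleR ext subsetD)
      finally have "norm (DF f x (exp_bump k w)) = c * norm (DF f x (exp_bump k ((1 / c) *\<^sub>R w)))"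
        using c by simp
      also have "\<dots> \<le> c * 1"
        using c by (intro mult_left_mono less_imp_le[OF lt]) (simp_all add: c_def)
      finally show ?thesis unfolding c_def by simp
    qed
  qed
qed

section \<open>Curves and tangent vectors\<close>

text \<open>Composes the extension with the continuous inclusion \<open>c1_incl\<close>. Joint
  continuity serves the chain rule, where base point and direction vary together.\<close>

lemma property_e_tendsto_DF:
  fixes f :: "(real^'n) c1map \<Rightarrow> real^'n"
  assumes "open U" "property_e U f" "\<phi> \<in> U"
  shows "((\<lambda>p. DF f (fst p) (snd p)) \<longlongrightarrow> DF f \<phi> \<zeta>) (nhds \<phi> \<times>\<^sub>F nhds \<zeta>)"
proof -
  obtain De :: "(real^'n) c1map \<Rightarrow> (real^'n) cmap \<Rightarrow> real^'n"
    where ext: "\<And>x \<zeta>. x \<in> U \<Longrightarrow> De x (c1_incl \<zeta>) = DF f x \<zeta>"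
      and cont: "continuous_on (U \<times> UNIV) (\<lambda>(x, \<zeta>). De x \<zeta>)"
    using assms(2) unfolding property_e_def by blast
  let ?G = "nhds \<phi> \<times>\<^sub>F nhds \<zeta>"
  have ev: "eventually (\<lambda>p. fst p \<in> U) ?G"
    using eventually_compose_filterlim[OF eventually_nhds_in_open[OF assms(1,3)] filterlim_fst] .
  have "((\<lambda>p. c1_incl (snd p)) \<longlongrightarrow> c1_incl \<zeta>) ?G"
    by (rule continuous_on_UNIV_tendsto[OF continuous_on_c1_incl filterlim_snd])
  then have "((\<lambda>p. (fst p, c1_incl (snd p))) \<longlongrightarrow> (\<phi>, c1_incl \<zeta>)) ?G"
    by (intro tendsto_Pair filterlim_fst)
  then have "((\<lambda>p. (\<lambda>(x, \<zeta>). De x \<zeta>) (fst p, c1_incl (snd p))) \<longlongrightarrow>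
      (\<lambda>(x, \<zeta>). De x \<zeta>) (\<phi>, c1_incl \<zeta>)) ?G"
    using assms(3) by (intro continuous_on_tendsto_compose[OF cont] eventually_mono[OF ev]) auto
  then have lim: "((\<lambda>p. De (fst p) (c1_incl (snd p))) \<longlongrightarrow> DF f \<phi> \<zeta>) ?G"
    by (simp add: ext[OF assms(3)])
  show ?thesis
    by (rule Lim_transform_eventually[OF lim eventually_mono[OF ev ext]])
qed

text \<open>The increment of the curve is \<open>t\<close> times \<open>q t\<close>, with
  \<open>q t\<close> tending to \<open>l\<close>. The mean value inequality on the segment from
  \<open>u\<close> to \<open>c t\<close> reduces the claim to the joint continuity assumed in
  \<open>DF\<close>.\<close>

lemma C1F_chain_rule_curve:
  fixes f :: "'a::real_tvs \<Rightarrow> 'b::real_normed_vector"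
  assumes smooth: "C1F_on U f" and "c 0 \<in> U"
    and DF: "((\<lambda>p. DF f (fst p) (snd p)) \<longlongrightarrow> DF f (c 0) l) (nhds (c 0) \<times>\<^sub>F nhds l)"
    and der: "has_dir_deriv c (0::real) 1 l"
  shows "has_dir_deriv (\<lambda>t. f (c t)) (0::real) 1 (DF f (c 0) l)"
proof -
  define u where "u = c 0"
  define q where "q t = (1 / t) *\<^sub>R (c t - u)" for t :: real
  have "open U" using smooth unfolding C1F_on_def by blast
  have q: "(q \<longlongrightarrow> l) (at 0)" using der unfolding has_dir_deriv_def q_def u_def by simp
  have tq: "((\<lambda>t. t *\<^sub>R q t) \<longlongrightarrow> 0) (at 0)"
    using tendsto_scaleR_tvs[OF tendsto_ident_at q] by simp
  have "((\<lambda>t. (1 / t) *\<^sub>R (f (c t) - f u)) \<longlongrightarrow> DF f u l) (at 0)"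
  proof (rule tendstoI)
    fix e :: real assume e: "e > 0"
    have "eventually (\<lambda>p. dist (DF f (fst p) (snd p)) (DF f u l) < e / 2) (nhds u \<times>\<^sub>F nhds l)"
      using DF e unfolding u_def by (intro tendstoD) auto
    then obtain P Q where PQ: "eventually P (nhds u)" "eventually Q (nhds l)"
        "\<And>x y. P x \<Longrightarrow> Q y \<Longrightarrow> dist (DF f x y) (DF f u l) < e / 2"
      unfolding eventually_prod_filter by auto
    have "eventually (\<lambda>x. x \<in> {x \<in> U. P x}) (nhds u)"
      using eventually_conj[OF eventually_nhds_in_open[OF \<open>open U\<close> assms(2)[folded u_def]] PQ(1)] by simp
    then have "eventually (\<lambda>t. \<forall>s\<in>{0..1}. u + s *\<^sub>R (t *\<^sub>R q t) \<in> {x \<in> U. P x}) (at 0)"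
      by (rule eventually_segment[OF tq])
    moreover have "eventually (\<lambda>t. Q (q t)) (at 0)"
      by (rule eventually_compose_filterlim[OF PQ(2) q])
    moreover have "eventually (\<lambda>t::real. t \<noteq> 0) (at 0)" by (simp add: eventually_at_filter)
    ultimately show "eventually (\<lambda>t. dist ((1 / t) *\<^sub>R (f (c t) - f u)) (DF f u l) < e) (at 0)"
    proof eventually_elim
      case (elim t)
      have eq: "u + t *\<^sub>R q t = c t" unfolding q_def using elim(3) by simp
      have "norm (f (u + t *\<^sub>R q t) - f u - t *\<^sub>R DF f u l) \<le> \<bar>t\<bar> * (e / 2)"
      proof (rule C1F_mean_value[OF smooth])
        fix s :: real assume "s \<in> {0..1}"
        then have x: "u + s *\<^sub>R (t *\<^sub>R q t) \<in> U" "P (u + s *\<^sub>R (t *\<^sub>R q t))" using elim(1) by auto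
        show "u + s *\<^sub>R (t *\<^sub>R q t) \<in> U" by fact
        have "DF f (u + s *\<^sub>R (t *\<^sub>R q t)) (t *\<^sub>R q t) - t *\<^sub>R DF f u l =
            t *\<^sub>R (DF f (u + s *\<^sub>R (t *\<^sub>R q t)) (q t) - DF f u l)"
          using linear_cmul[OF C1F_onD(2)[OF smooth x(1)]] by (simp add: scaleR_diff_right)
        then show "norm (DF f (u + s *\<^sub>R (t *\<^sub>R q t)) (t *\<^sub>R q t) - t *\<^sub>R DF f u l) \<le> \<bar>t\<bar> * (e / 2)"
          using PQ(3)[OF x(2) elim(2)] unfolding dist_norm
          by (metis norm_scaleR abs_ge_zero less_imp_le mult_left_mono real_norm_def)
      qed
      then have "norm (f (c t) - f u - t *\<^sub>R DF f u l) \<le> \<bar>t\<bar> * (e / 2)" unfolding eq .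
      moreover have "dist ((1 / t) *\<^sub>R (f (c t) - f u)) (DF f u l) = norm (f (c t) - f u - t *\<^sub>R DF f u l) / \<bar>t\<bar>"
      proof -
        have "(1 / t) *\<^sub>R (f (c t) - f u) - DF f u l = (1 / t) *\<^sub>R (f (c t) - f u - t *\<^sub>R DF f u l)"
          using elim(3) by (simp add: scaleR_diff_right)
        then show ?thesis by (simp add: dist_norm)
      qed
      moreover have "\<bar>t\<bar> * (e / 2) / \<bar>t\<bar> = e / 2" using elim(3) by simp
      ultimately have "dist ((1 / t) *\<^sub>R (f (c t) - f u)) (DF f u l) \<le> e / 2"
        by (metis abs_ge_zero divide_right_mono)
      then show ?case using e by simp
    qed
  qed
  then show ?thesis unfolding has_dir_deriv_def u_def by simp
qed

text \<open>Differentiates \<open>deriv0 (c t) = f (c t)\<close> at zero: the left side by linearity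
  and continuity of \<open>deriv0\<close>, the right side by the chain rule.\<close>

lemma deriv0_tangent_vector:
  fixes f :: "(real^'n) c1map \<Rightarrow> real^'n"
  assumes "C1F_on U f" "property_e U f"
    and "\<zeta> \<in> tangent_vectors \<phi> (solution_manifold U f)"
  shows "deriv0 \<zeta> = DF f \<phi> \<zeta>"
proof -
  obtain c I where c: "\<zeta> = DF c 0 1" "open I" "0 \<in> I" "C1_curve_on I c" "c 0 = \<phi>"
      "c ` I \<subseteq> solution_manifold U f"
    using assms(3) unfolding tangent_vectors_def by blast
  have der: "has_dir_deriv c 0 1 \<zeta>"
    using c(1,3,4) DF_eqI unfolding C1_curve_on_def by metis
  have sol: "c t \<in> U" "deriv0 (c t) = f (c t)" if "t \<in> I" for t
    using c(6) that unfolding solution_manifold_def deriv0_def by auto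
  have U: "open U" using assms(1) unfolding C1F_on_def by blast
  have "has_dir_deriv (\<lambda>t. f (c t)) 0 1 (DF f (c 0) \<zeta>)"
    by (intro C1F_chain_rule_curve[OF assms(1) _ _ der] property_e_tendsto_DF[OF U assms(2)] sol c(3))
  then have lim: "((\<lambda>t. (1 / t) *\<^sub>R (f (c t) - f \<phi>)) \<longlongrightarrow> DF f \<phi> \<zeta>) (at 0)"
    unfolding has_dir_deriv_def by (simp add: c(5))
  have "((\<lambda>t. (1 / t) *\<^sub>R (c t - \<phi>)) \<longlongrightarrow> \<zeta>) (at 0)"
    using der unfolding has_dir_deriv_def by (simp add: c(5))
  then have "((\<lambda>t. deriv0 ((1 / t) *\<^sub>R (c t - \<phi>))) \<longlongrightarrow> deriv0 \<zeta>) (at 0)"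
    by (rule continuous_on_UNIV_tendsto[OF continuous_on_deriv0])
  moreover have "eventually (\<lambda>t. deriv0 ((1 / t) *\<^sub>R (c t - \<phi>)) = (1 / t) *\<^sub>R (f (c t) - f \<phi>)) (at 0)"
  proof -
    have "eventually (\<lambda>t. t \<in> I) (at 0)" using c(2,3) by (rule eventually_at_in_open')
    then show ?thesis
      by (rule eventually_mono)
        (use sol c(3,5) in \<open>auto simp: linear_cmul[OF linear_deriv0] linear_diff[OF linear_deriv0]\<close>)
  qed
  ultimately have "((\<lambda>t. (1 / t) *\<^sub>R (f (c t) - f \<phi>)) \<longlongrightarrow> deriv0 \<zeta>) (at 0)"
    by (rule Lim_transform_eventually)
  then show ?thesis using lim by (intro tendsto_unique[of "at (0::real)"]) auto
qed

text \<open>The line through \<open>K \<phi>\<close> with direction \<open>T \<phi> \<zeta>\<close>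
  stays in \<open>G\<close>; near \<open>K \<phi>\<close>, \<open>J\<close> maps it to a curve in
  \<open>M\<close> with velocity \<open>inv (T \<phi>) (T \<phi> \<zeta>) = \<zeta>\<close> at
  zero.\<close>

lemma (in finite_rank_perturbation) tangent_vector_J:
  assumes M: "\<And>\<psi>. \<psi> \<in> K ` N \<Longrightarrow> \<psi> \<in> G \<Longrightarrow> J \<psi> \<in> M"
    and "subspace G" "\<phi> \<in> N" "K \<phi> \<in> G" "T \<phi> \<zeta> \<in> G"
  shows "\<zeta> \<in> tangent_vectors \<phi> M"
proof -
  define \<psi> \<eta> where "\<psi> = K \<phi>" and "\<eta> = T \<phi> \<zeta>"
  define c where "c t = J (\<psi> + t *\<^sub>R \<eta>)" for t :: real
  have path: "((\<lambda>t. \<psi> + t *\<^sub>R \<eta>) \<longlongrightarrow> \<psi> + t *\<^sub>R \<eta>) (at t within A)" for t A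
    by (intro tendsto_add tendsto_const tendsto_scaleR_tvs tendsto_ident_at)
  have "((\<lambda>t. \<psi> + t *\<^sub>R \<eta>) \<longlongrightarrow> \<psi>) (nhds 0)"
    using path[of 0 UNIV] tendsto_at_iff_tendsto_nhds[of "\<lambda>t. \<psi> + t *\<^sub>R \<eta>" 0] by simp
  then have "eventually (\<lambda>t. \<psi> + t *\<^sub>R \<eta> \<in> K ` N) (nhds 0)"
    using open_image_K assms(3) unfolding \<psi>_def by (intro topological_tendstoD) auto
  then obtain r where r: "r > 0" "\<And>t. \<bar>t\<bar> < r \<Longrightarrow> \<psi> + t *\<^sub>R \<eta> \<in> K ` N"
    unfolding eventually_nhds_metric by auto
  have der: "has_dir_deriv c t 1 (DF J (\<psi> + t *\<^sub>R \<eta>) \<eta>)" if "t \<in> ball 0 r" for t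
  proof -
    have "has_dir_deriv J (\<psi> + t *\<^sub>R \<eta>) \<eta> (DF J (\<psi> + t *\<^sub>R \<eta>) \<eta>)"
      using r(2) that by (intro C1F_onD(1)[OF C1F_on_J]) auto
    then show ?thesis unfolding has_dir_deriv_def c_def by (simp add: scaleR_add_left add.assoc)
  qed
  have "continuous_on (ball 0 r) (\<lambda>t. DF J (\<psi> + t *\<^sub>R \<eta>) \<eta>)"
    unfolding continuous_on_def
  proof
    fix t :: real assume t: "t \<in> ball 0 r"
    have w: "\<psi> + t *\<^sub>R \<eta> \<in> K ` N" using r(2) t by simp
    have beta: "continuous_map (top_of_set (K ` N)) beta (DF J)"
      using C1F_on_J unfolding C1F_on_def by blast
    \<comment> \<open>Continuity of \<open>DF J\<close> into \<open>beta\<close>, tested on the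
      singleton of \<open>\<eta>\<close>, makes the velocity of \<open>c\<close> continuous.\<close>
    have "((\<lambda>y. DF J y \<eta> - DF J (\<psi> + t *\<^sub>R \<eta>) \<eta>) \<longlongrightarrow> 0) (nhds (\<psi> + t *\<^sub>R \<eta>))"
    proof (rule topological_tendstoI)
      fix S :: "'a set" assume "open S" "0 \<in> S"
      then show "eventually (\<lambda>y. DF J y \<eta> - DF J (\<psi> + t *\<^sub>R \<eta>) \<eta> \<in> S) (nhds (\<psi> + t *\<^sub>R \<eta>))"
        using continuous_map_betaD[OF beta open_image_K w tvs_bounded_singleton[of \<eta>]] by simp
    qed
    then have "((\<lambda>y. DF J y \<eta> - DF J (\<psi> + t *\<^sub>R \<eta>) \<eta> + DF J (\<psi> + t *\<^sub>R \<eta>) \<eta>) \<longlongrightarrow>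
        0 + DF J (\<psi> + t *\<^sub>R \<eta>) \<eta>) (nhds (\<psi> + t *\<^sub>R \<eta>))"
      by (intro tendsto_add tendsto_const)
    then have "((\<lambda>y. DF J y \<eta>) \<longlongrightarrow> DF J (\<psi> + t *\<^sub>R \<eta>) \<eta>) (nhds (\<psi> + t *\<^sub>R \<eta>))" by simp
    then show "((\<lambda>t. DF J (\<psi> + t *\<^sub>R \<eta>) \<eta>) \<longlongrightarrow> DF J (\<psi> + t *\<^sub>R \<eta>) \<eta>) (at t within ball 0 r)"
      by (rule filterlim_compose[OF _ path])
  qed
  then have "continuous_on (ball 0 r) (\<lambda>t. DF c t 1)"
    by (rule continuous_on_eq) (simp add: DF_eqI[OF der])
  then have C1: "C1_curve_on (ball 0 r) c"
    unfolding C1_curve_on_def using der by blast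
  have J\<psi>: "J \<psi> = \<phi>" unfolding \<psi>_def by (rule J_K[OF assms(3)])
  have "DF c 0 1 = inv (T (J \<psi>)) \<eta>"
    using DF_eqI[OF der[of 0]] r(1) DF_J[of \<psi> \<eta>] assms(3) by (simp add: \<psi>_def)
  then have "\<zeta> = DF c 0 1"
    using inv_T_T[OF assms(3)] unfolding J\<psi> \<eta>_def by simp
  moreover have "c t \<in> M" if "t \<in> ball 0 r" for t
  proof -
    have "\<psi> + t *\<^sub>R \<eta> \<in> G"
      using assms(2,4,5) unfolding \<psi>_def \<eta>_def by (intro subspace_add subspace_mul)
    then show ?thesis unfolding c_def using that by (intro M r(2)) auto
  qed
  then have "c ` ball 0 r \<subseteq> M" by blast
  moreover have "c 0 = \<phi>" unfolding c_def using J\<psi> by simp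
  ultimately show ?thesis
    unfolding tangent_vectors_def using C1 r(1)
    by (intro CollectI exI[of _ c] exI[of _ "ball 0 r"]) (auto simp: is_interval_ball_real)
qed

theorem proposition9p3:
  fixes U :: "(real^'n) c1map set"
    and f :: "(real^'n) c1map \<Rightarrow> real^'n"
  assumes "open U"
    and "C1F_on U f"
    and "property_e U f"
    and "solution_manifold U f \<noteq> {}"
  shows "C1F_submanifold_codim (solution_manifold U f) CARD('n) \<and>
    (\<forall>\<phi>\<in>solution_manifold U f.
       tangent_vectors \<phi> (solution_manifold U f) =
         {\<psi>. cmap_apply (c1_deriv \<psi>) 0 = DF f \<phi> \<psi>})"
proof -
  let ?X = "solution_manifold U f"
  \<comment> \<open>Neither \<open>\<phi>\<close> nor \<open>k\<close> enters, so all charts share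
    this model space.\<close>
  define G where "G = {\<zeta> :: (real^'n) c1map. deriv0 \<zeta> = 0}"
  have local: "(\<exists>P W K. \<phi> \<in> P \<and> C1F_diffeomorphism P W K \<and> K ` (?X \<inter> P) = W \<inter> G) \<and>
      {\<zeta>. deriv0 \<zeta> = DF f \<phi> \<zeta>} \<subseteq> tangent_vectors \<phi> ?X" if \<phi>: "\<phi> \<in> ?X" for \<phi>
  proof -
    have "\<phi> \<in> U" using \<phi> unfolding solution_manifold_def by blast
    obtain k N where N: "open N" "\<phi> \<in> N" "N \<subseteq> U" "convex N"
        "\<And>x w. x \<in> N \<Longrightarrow> norm (DF f x (exp_bump k w)) \<le> norm w / 2"
      by (rule property_e_small_exp_bump[OF assms(1,3) \<open>\<phi> \<in> U\<close>]) (rule that)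
    interpret finite_rank_perturbation N f "exp_bump k"
      by (intro finite_rank_perturbation.intro C1F_on_subset[OF assms(2)] N linear_exp_bump)
    \<comment> \<open>\<open>deriv0 (K x) = deriv0 x - f x\<close>, because \<open>deriv0\<close>
      undoes \<open>exp_bump k\<close>; likewise \<open>deriv0 (T \<phi> \<zeta>) = deriv0 \<zeta> -
      DF f \<phi> \<zeta>\<close> below.\<close>
    have K_G: "K x \<in> G \<longleftrightarrow> x \<in> ?X" if "x \<in> N" for x
      using that N(3) unfolding K_def G_def solution_manifold_def
      by (auto simp: linear_diff[OF linear_deriv0] deriv0_exp_bump simp flip: deriv0_def)
    then have "K ` (?X \<inter> N) = K ` N \<inter> G" by blast
    moreover have "{\<zeta>. deriv0 \<zeta> = DF f \<phi> \<zeta>} \<subseteq> tangent_vectors \<phi> ?X"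
    proof
      fix \<zeta> assume "\<zeta> \<in> {\<zeta>. deriv0 \<zeta> = DF f \<phi> \<zeta>}"
      then have "T \<phi> \<zeta> \<in> G"
        unfolding T_def G_def by (simp add: linear_diff[OF linear_deriv0] deriv0_exp_bump)
      moreover have "subspace G" unfolding G_def by (rule linear_subspace_kernel[OF linear_deriv0])
      moreover have "J \<psi> \<in> ?X" if "\<psi> \<in> K ` N" "\<psi> \<in> G" for \<psi>
        using K_G[OF J_in_N[OF that(1)]] K_J[OF that(1)] that(2) by simp
      ultimately show "\<zeta> \<in> tangent_vectors \<phi> ?X"
        using N(2) K_G[OF N(2)] \<phi> by (intro tangent_vector_J[of G]) auto
    qed
    ultimately show ?thesis using N(2) C1F_diffeomorphism_K by blast
  qed
  have "C1F_submanifold_codim ?X CARD('n)"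
    unfolding C1F_submanifold_codim_def
  proof (intro exI conjI)
    \<comment> \<open>The charts use a \<open>k\<close> depending on \<open>\<phi>\<close>, but one
      complement of \<open>G\<close> must be fixed; \<open>k = 0\<close> gives the functions
      \<open>t\<close> times \<open>v\<close>.\<close>
    show "closed_direct_sum G (range (exp_bump 0))"
      unfolding G_def by (rule closed_direct_sum_exp_bump)
    show "finite (exp_bump 0 ` (Basis :: (real^'n) set))" by simp
    show "span (exp_bump 0 ` Basis) = range (exp_bump 0 :: real^'n \<Rightarrow> _)"
      by (rule span_exp_bump_Basis)
    show "dim (range (exp_bump 0 :: real^'n \<Rightarrow> _)) = CARD('n)"
      by (simp add: dim_range_exp_bump)
    show "C1F_submanifold_over G ?X"
      unfolding C1F_submanifold_over_def using local by blast
  qed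
  moreover have "tangent_vectors \<phi> ?X = {\<psi>. deriv0 \<psi> = DF f \<phi> \<psi>}" if "\<phi> \<in> ?X" for \<phi>
    using local[OF that] deriv0_tangent_vector[OF assms(2,3)] by blast
  ultimately show ?thesis unfolding deriv0_def by blast
qed

end
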